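(* Let $q$ be a prime power. For $a\in\mathbb{Z}$ and $t>0$, let $Z_{a,t}$ be the process defined in the context started from $Z_{a,0}=a$, and let $D_{a,t}$ be the number of downward jumps made by this process until time $t$ (including a possible jump at time $t$ provided that it is a downward jump). Then for any fixed $t>0$, as $a$ tends to $-\infty$, the pair $(D_{a,t},Z_{a,t})$ converges in total variation distance to some random variable $(D_{-\infty,t},Z_{-\infty,t})$.
   Context: $(Z_t)_{t\ge 0}$ is the continuous time Markov chain on $\mathbb{Z}$ with transition rates $Q_Z(a,a+1)=q^{-a}$, $Q_Z(a,a-1)=q^{a}$, $Q_Z(a,a)=-q^a-q^{-a}$, and $Q_Z(a,b)=0$ otherwise (it has no explosions). A downward jump is a jump from some $b$ to $b-1$. The notation $Z_{a,t}$ refers to this process with deterministic initial state $Z_0=a$. *)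

theory Defs
  imports "HOL-Probability.Probability" "HOL-Number_Theory.Prime_Powers"
begin

text \<open>
  A path is a function on real time of which only the values at times \<open>t \<ge> 0\<close> are used.
  With a discrete state space, a path that is right-continuous with left limits makes only
  finitely many jumps in every bounded time interval, so there is no explosion.
\<close>

definition cadlag :: "(real \<Rightarrow> 'a::topological_space) \<Rightarrow> bool" where
  "cadlag f \<longleftrightarrow>
     (\<forall>t\<ge>0. continuous (at_right t) f) \<and> (\<forall>t>0. \<exists>l. (f \<longlongrightarrow> l) (at_left t))"

text \<open>
  The infimum of the empty set is \<open>\<infinity>\<close>. Once some jump time is \<open>\<infinity>\<close>, so are all later ones,
  and the junk value \<open>f (real_of_ereal \<infinity>)\<close> in the second equation is irrelevant because the
  set is then empty.
\<close>

primrec jump_time :: "(real \<Rightarrow> 'a) \<Rightarrow> nat \<Rightarrow> ereal" where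
  "jump_time f 0 = 0"
| "jump_time f (Suc n) =
     Inf {ereal t | t. jump_time f n < ereal t \<and> f t \<noteq> f (real_of_ereal (jump_time f n))}"

primrec jump_chain :: "(real \<Rightarrow> 'a) \<Rightarrow> nat \<Rightarrow> 'a" where
  "jump_chain f 0 = f 0"
| "jump_chain f (Suc n) =
     (if jump_time f (Suc n) = \<infinity> then jump_chain f n
      else f (real_of_ereal (jump_time f (Suc n))))"

text \<open>In \<open>ereal\<close>, \<open>\<infinity> - \<infinity> = \<infinity>\<close>: holding times after the last jump are infinite.\<close>

definition holding_time :: "(real \<Rightarrow> 'a) \<Rightarrow> nat \<Rightarrow> ereal" where
  "holding_time f n = jump_time f (Suc n) - jump_time f n"

definition jump_prob :: "('a \<Rightarrow> 'a \<Rightarrow> real) \<Rightarrow> 'a \<Rightarrow> 'a \<Rightarrow> real" where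
  "jump_prob Q x y =
     (if Q x x = 0 then of_bool (x = y) else if x = y then 0 else Q x y / (- Q x x))"

text \<open>
  Continuous-time Markov chain with transition rate matrix \<open>Q\<close>, started from \<open>x\<close>, by its
  jump chain and holding times: the jump chain \<open>Y\<close> is a discrete-time Markov chain with
  transition matrix \<open>jump_prob Q\<close> started from \<open>x\<close>, and conditionally on \<open>Y\<^sub>0, \<dots>, Y\<^sub>n\<close> the
  holding times \<open>S\<^sub>0, \<dots>, S\<^sub>n\<close> are independent exponential variables with parameters
  \<open>- Q Y\<^sub>0 Y\<^sub>0, \<dots>, - Q Y\<^sub>n Y\<^sub>n\<close>.
\<close>

locale ctmc = prob_space M for M :: "'w measure" +
  fixes Q :: "'a::discrete_topology \<Rightarrow> 'a \<Rightarrow> real" and x :: 'a and Z :: "real \<Rightarrow> 'w \<Rightarrow> 'a"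
  assumes measurable_Z: "\<And>t. t \<ge> 0 \<Longrightarrow> Z t \<in> measurable M (count_space UNIV)"
    and cadlag_paths: "\<And>\<omega>. \<omega> \<in> space M \<Longrightarrow> cadlag (\<lambda>t. Z t \<omega>)"
    and jump_chain_law: "\<And>n (y :: nat \<Rightarrow> 'a).
      \<P>(\<omega> in M. \<forall>k\<le>n. jump_chain (\<lambda>t. Z t \<omega>) k = y k)
        = of_bool (y 0 = x) * (\<Prod>k<n. jump_prob Q (y k) (y (Suc k)))"
    and holding_time_law: "\<And>n (y :: nat \<Rightarrow> 'a) (s :: nat \<Rightarrow> real).
      (\<forall>k\<le>n. s k \<ge> 0) \<Longrightarrow>
      \<P>(\<omega> in M. \<forall>k\<le>n. jump_chain (\<lambda>t. Z t \<omega>) k = y k \<and> holding_time (\<lambda>t. Z t \<omega>) k > s k)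
        = \<P>(\<omega> in M. \<forall>k\<le>n. jump_chain (\<lambda>t. Z t \<omega>) k = y k)
            * (\<Prod>k\<le>n. exp (Q (y k) (y k) * s k))"

definition Q_Z :: "nat \<Rightarrow> int \<Rightarrow> int \<Rightarrow> real" where
  "Q_Z q a b =
     (if b = a + 1 then real q powi (- a)
      else if b = a - 1 then real q powi a
      else if b = a then - (real q powi a) - real q powi (- a)
      else 0)"

definition down_jumps :: "(real \<Rightarrow> int) \<Rightarrow> real \<Rightarrow> nat" where
  "down_jumps f t = card {s \<in> {0<..t}. (f \<longlongrightarrow> f s + 1) (at_left s)}"

text \<open>Used for probability measures with the same measurable sets.\<close>

definition tv_dist :: "'a measure \<Rightarrow> 'a measure \<Rightarrow> real" where
  "tv_dist M N = (SUP A\<in>sets M. \<bar>measure M A - measure N A\<bar>)"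

end

theory Submission
  imports Defs
begin

text \<open>
  Far below zero the chain is driven almost deterministically upwards: at a very negative \<open>a\<close> it
  jumps up at the enormous rate \<open>q powi (-a)\<close> and down at the tiny rate \<open>q powi a\<close>. Starting at \<open>a\<close>
  instead of \<open>a + 1\<close> should therefore cost only a short delay and a small probability of an extra
  downward jump, and the costs should be summable over all \<open>a\<close>.

  The proof makes this quantitative through the backward equation. For a set \<open>A\<close> of pairs \<open>(d, z)\<close>
  let \<open>p A a t\<close> be the probability that the number of downward jumps and the position at time \<open>t\<close>,
  for the chain started in \<open>a\<close>, form a pair in \<open>A\<close> (\<open>end_prob\<close> below). Conditioning on the first
  jump gives
  \<open>p A a\<close>' = \<open>q powi (-a) * (p A (a + 1) - p A a) + q powi a * (p A' (a - 1) - p A a)\<close>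
  where \<open>A'\<close> is \<open>A\<close> shifted by the downward jump already made. Solved for the first difference, this says
  \<open>p A (a + 1) t - p A a t\<close> = \<open>q powi a\<close> * (time derivative of \<open>p A a\<close> at \<open>t\<close>) + \<open>O(q powi (2 * a))\<close>
  as \<open>a\<close> tends to \<open>-\<infinity>\<close>, uniformly in \<open>A\<close>. So the laws for \<open>a = 0, -1, -2, \<dots>\<close> form a Cauchy sequence
  in total variation as soon as, at the fixed time \<open>t\<close>, the derivative grows more slowly than
  \<open>q powi (-a)\<close> by a summable factor.

  The trivial bound on the derivative is the total rate \<open>q powi a + q powi (-a)\<close>, which just fails.
  The remedy is to look at \<open>t\<close> times the derivative. It vanishes at time \<open>0\<close> and solves a linear
  equation that pulls it, at rate \<open>q powi (-a) + q powi a\<close>, towards the corresponding quantity for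
  \<open>a + 1\<close>; the error terms are of the size of this rate. Hence a step from \<open>a + 1\<close> down to \<open>a\<close> adds only a
  constant to the bound, and \<open>t\<close> times the derivative grows at most linearly in \<open>-a\<close>
  (\<open>scaled_velocity_bound\<close>). The neighbouring laws then differ by \<open>O((n + 1) * (1/2)^n)\<close> at depth
  \<open>n = -a\<close> (\<open>end_prob_neighbour_bound\<close>), and completeness of the space of probability measures under total
  variation (\<open>tv_Cauchy_imp_convergent\<close>) provides the limit.

  The backward equation has to be derived from the description of the chain by its jump chain and
  holding times. On the side of paths, the position and the number of downward jumps at time \<open>t\<close> are
  read off from the sequence of visited states and holding times (\<open>down_jumps_history\<close>). On the side
  of laws, this sequence is a random stream whose law is determined by its finite-dimensional
  cylinder probabilities, so it is the law of an exponential time and a first step followed by an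
  independent copy of the stream for the new starting point (\<open>H_eq_bind_step\<close>).
\<close>

section \<open>Jump times of right-continuous paths with left limits\<close>

lemma cadlag_right_constant:
  fixes f :: "real \<Rightarrow> 'a::discrete_topology"
  assumes "cadlag f" "r \<ge> 0"
  obtains e where "e > r" "\<And>s. r \<le> s \<Longrightarrow> s < e \<Longrightarrow> f s = f r"
proof -
  have "(f \<longlongrightarrow> f r) (at_right r)"
    using assms by (auto simp: cadlag_def continuous_within)
  then have "\<forall>\<^sub>F s in at_right r. f s = f r"
    by (simp add: tendsto_discrete)
  then obtain e where "e > r" "\<And>s. r < s \<Longrightarrow> s < e \<Longrightarrow> f s = f r"
    by (auto simp: eventually_at_right_field)
  then show ?thesis
    using that[of e] by (metis order_le_less)
qed

lemma cadlag_left_constant: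
  fixes f :: "real \<Rightarrow> 'a::discrete_topology"
  assumes "cadlag f" "r > 0"
  obtains l e where "e < r" "0 \<le> e" "\<And>s. e < s \<Longrightarrow> s < r \<Longrightarrow> f s = l"
proof -
  obtain l where "(f \<longlongrightarrow> l) (at_left r)"
    using assms by (auto simp: cadlag_def)
  then have "\<forall>\<^sub>F s in at_left r. f s = l"
    by (simp add: tendsto_discrete)
  then obtain e where "e < r" "\<And>s. e < s \<Longrightarrow> s < r \<Longrightarrow> f s = l"
    by (auto simp: eventually_at_left_field)
  then show ?thesis
    using that[of "max e 0" l] assms by auto
qed

declare jump_time.simps(2) [simp del] jump_chain.simps(2) [simp del]

lemma jump_time_Suc_le:
  assumes "jump_time f n = ereal r" "r < s" "f s \<noteq> f r"
  shows "jump_time f (Suc n) \<le> ereal s"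
  using assms by (auto intro!: Inf_lower simp: jump_time.simps(2))

lemma le_jump_time_Suc:
  assumes "jump_time f n = ereal r" "\<And>s. r < s \<Longrightarrow> f s \<noteq> f r \<Longrightarrow> b \<le> ereal s"
  shows "b \<le> jump_time f (Suc n)"
  using assms by (auto intro!: Inf_greatest simp: jump_time.simps(2))

lemma jump_time_mono: "m \<le> n \<Longrightarrow> jump_time f m \<le> jump_time f n"
  by (rule lift_Suc_mono_le[of "jump_time f"])
     (auto intro!: Inf_greatest simp: jump_time.simps(2))

lemma jump_time_nonneg: "0 \<le> jump_time f n"
  using jump_time_mono[of 0 n f] by simp

lemma constant_before_jump:
  assumes "jump_time f n = ereal r" "r \<le> s" "ereal s < jump_time f (Suc n)"
  shows "f s = f r"
proof (rule ccontr)
  assume "f s \<noteq> f r"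
  with assms(2) have "r < s" by (cases "r = s") auto
  then have "jump_time f (Suc n) \<le> ereal s"
    using assms(1) \<open>f s \<noteq> f r\<close> by (intro jump_time_Suc_le)
  with assms(3) show False by simp
qed

lemma jump_time_less_Suc:
  fixes f :: "real \<Rightarrow> 'a::discrete_topology"
  assumes "cadlag f" "jump_time f n = ereal r"
  shows "jump_time f n < jump_time f (Suc n)"
proof -
  have "r \<ge> 0" using jump_time_nonneg[of f n] assms by simp
  then obtain e where e: "e > r" "\<And>s. r \<le> s \<Longrightarrow> s < e \<Longrightarrow> f s = f r"
    using cadlag_right_constant assms(1) by metis
  have "ereal e \<le> jump_time f (Suc n)"
  proof (rule le_jump_time_Suc[OF assms(2)])
    fix s assume s: "r < s" "f s \<noteq> f r"
    then have "\<not> s < e" using e(2)[of s] by auto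
    then show "ereal e \<le> ereal s" by simp
  qed
  moreover have "jump_time f n < ereal e" using e(1) assms(2) by simp
  ultimately show ?thesis by (rule less_le_trans[rotated])
qed

lemma jump_at_jump_time:
  fixes f :: "real \<Rightarrow> 'a::discrete_topology"
  assumes "cadlag f" "jump_time f n = ereal r" "jump_time f (Suc n) = ereal r'"
  shows "f r' \<noteq> f r"
proof
  assume eq: "f r' = f r"
  have "r' \<ge> 0" using jump_time_nonneg[of f "Suc n"] assms by simp
  then obtain e where e: "e > r'" "\<And>s. r' \<le> s \<Longrightarrow> s < e \<Longrightarrow> f s = f r'"
    using cadlag_right_constant assms(1) by metis
  have "ereal e \<le> jump_time f (Suc n)"
  proof (rule le_jump_time_Suc[OF assms(2)])
    fix s assume s: "r < s" "f s \<noteq> f r"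
    then have "r' \<le> s" using jump_time_Suc_le[OF assms(2) s] assms(3) by simp
    then have "\<not> s < e" using e(2)[of s] s(2) eq by auto
    then show "ereal e \<le> ereal s" by simp
  qed
  with e(1) assms(3) show False by simp
qed

text \<open>
  The left limit at an accumulation point of jump times would not exist. This is what excludes
  explosion.
\<close>

lemma jump_times_unbounded:
  fixes f :: "real \<Rightarrow> 'a::discrete_topology"
  assumes "cadlag f"
  shows "\<exists>n. ereal t < jump_time f n"
proof (rule ccontr)
  assume "\<not> ?thesis"
  then have le: "jump_time f n \<le> ereal t" for n by (simp add: not_less)
  define r where "r n = real_of_ereal (jump_time f n)" for n
  have r: "jump_time f n = ereal (r n)" for n
    using le[of n] jump_time_nonneg[of f n] unfolding r_def
    by (cases "jump_time f n") auto
  have less: "r n < r (Suc n)" for n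
    using jump_time_less_Suc[OF assms r[of n]] r by simp
  have bdd: "bdd_above (range r)"
    using le r by (auto intro!: bdd_aboveI[of _ t])
  define T where "T = (SUP n. r n)"
  have rT: "r n < T" for n
    using less[of n] cSUP_upper[OF UNIV_I bdd, of "Suc n"] unfolding T_def by simp
  have "r 0 = 0" using r[of 0] by (simp add: zero_ereal_def)
  then have "T > 0" using rT[of 0] by simp
  then obtain l e where e: "e < T" "\<And>s. e < s \<Longrightarrow> s < T \<Longrightarrow> f s = l"
    using cadlag_left_constant[OF assms] by metis
  obtain n where n: "e < r n"
    using e(1) unfolding T_def by (subst (asm) less_cSUP_iff[OF _ bdd]) auto
  then have "f (r n) = l" "f (r (Suc n)) = l"
    using e(2) rT less[of n] by (auto intro: less_trans)
  then show False
    using jump_at_jump_time[OF assms r r, of n] by simp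
qed

lemma jump_interval_exists:
  fixes f :: "real \<Rightarrow> 'a::discrete_topology"
  assumes "cadlag f" "t \<ge> 0"
  obtains n where "jump_time f n \<le> ereal t" "ereal t < jump_time f (Suc n)"
proof -
  define m where "m = (LEAST n. ereal t < jump_time f n)"
  have m: "ereal t < jump_time f m"
    unfolding m_def using jump_times_unbounded[OF assms(1)] by (rule LeastI_ex)
  with assms(2) obtain n where n: "m = Suc n"
    by (cases m) (auto simp: zero_ereal_def)
  then have "\<not> ereal t < jump_time f n"
    using not_less_Least[of n "\<lambda>n. ereal t < jump_time f n"] unfolding m_def by auto
  with m n that show ?thesis by (auto simp: not_less)
qed

lemma jump_chain_eq:
  assumes "jump_time f n = ereal r"
  shows "jump_chain f n = f r"
  using assms by (cases n) (auto simp: zero_ereal_def jump_chain.simps(2))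

lemma jump_chain_at:
  assumes "jump_time f n \<le> ereal t" "ereal t < jump_time f (Suc n)"
  shows "f t = jump_chain f n"
proof -
  obtain r where r: "jump_time f n = ereal r"
    using assms(1) jump_time_nonneg[of f n] by (cases "jump_time f n") auto
  show ?thesis
    using constant_before_jump[OF r _ assms(2)] jump_chain_eq[OF r] assms(1) r by simp
qed

text \<open>
  A path that is constant just before \<open>s\<close> has that constant as its only left limit. This covers both
  jump times and continuity points in the count of downward jumps.
\<close>

lemma left_limit_iff:
  fixes f :: "real \<Rightarrow> 'a::discrete_topology"
  assumes "r < s" "\<And>u. r < u \<Longrightarrow> u < s \<Longrightarrow> f u = c"
  shows "(f \<longlongrightarrow> l) (at_left s) \<longleftrightarrow> l = c"
proof -
  have ev: "\<forall>\<^sub>F u in at_left s. f u = c"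
    using assms by (auto simp: eventually_at_left_field intro!: exI[of _ r])
  show ?thesis
  proof
    assume "(f \<longlongrightarrow> l) (at_left s)"
    then have "\<forall>\<^sub>F u in at_left s. f u = l" by (simp add: tendsto_discrete)
    with ev have "\<forall>\<^sub>F u in at_left s. l = c" by eventually_elim auto
    then show "l = c" by simp
  next
    assume "l = c"
    with ev show "(f \<longlongrightarrow> l) (at_left s)" by (simp add: tendsto_discrete)
  qed
qed

text \<open>
  A time \<open>s\<close> at which the left limit exceeds the value by one is a jump time, since between jump
  times the left limit is the value itself; and at the jump time number \<open>k + 1\<close> the left limit is the
  \<open>k\<close>-th state of the jump chain. Jump times are strictly increasing, so distinct indices are
  distinct times.
\<close>

lemma down_jumps_eq:
  fixes f :: "real \<Rightarrow> int"
  assumes "cadlag f" "jump_time f n \<le> ereal t" "ereal t < jump_time f (Suc n)"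
  shows "down_jumps f t = card {k. k < n \<and> jump_chain f (Suc k) = jump_chain f k - 1}"
proof -
  define r where "r k = real_of_ereal (jump_time f k)" for k
  have r: "jump_time f k = ereal (r k)" if "k \<le> n" for k
    using jump_time_mono[OF that, of f] assms(2) jump_time_nonneg[of f k] unfolding r_def
    by (cases "jump_time f k") auto
  have less: "r k < r (Suc k)" if "k < n" for k
    using jump_time_less_Suc[OF assms(1) r, of k] r[of k] r[of "Suc k"] that by simp
  have mono: "r k < r l" if "k < l" "l \<le> n" for k l
    using that
  proof (induction l)
    case (Suc l)
    then show ?case using less[of l] by (cases "k = l") auto
  qed simp
  have r0: "r 0 = 0" by (simp add: r_def)
  have rn: "r n \<le> t" using assms(2) r[of n] by simp
  have lim: "(f \<longlongrightarrow> l) (at_left s) \<longleftrightarrow> l = f (r k)"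
    if "jump_time f k = ereal (r k)" "r k < s" "ereal s \<le> jump_time f (Suc k)" for k s l
  proof (rule left_limit_iff[OF that(2)])
    fix u assume "r k < u" "u < s"
    then have "ereal u < jump_time f (Suc k)"
      using that(3) less_le_trans[of "ereal u" "ereal s"] by simp
    then show "f u = f (r k)"
      using \<open>r k < u\<close> by (intro constant_before_jump[OF that(1)]) auto
  qed
  let ?K = "{k. k < n \<and> jump_chain f (Suc k) = jump_chain f k - 1}"
  have "{s \<in> {0<..t}. (f \<longlongrightarrow> f s + 1) (at_left s)} = (\<lambda>k. r (Suc k)) ` ?K" (is "?L = ?R")
  proof
    show "?L \<subseteq> ?R"
    proof
      fix s assume "s \<in> ?L"
      then have s: "0 < s" "s \<le> t" "(f \<longlongrightarrow> f s + 1) (at_left s)" by auto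
      define m where "m = (LEAST k. ereal s \<le> jump_time f k)"
      have "\<exists>k. ereal s \<le> jump_time f k"
        using jump_times_unbounded[OF assms(1), of s] less_imp_le by blast
      then have m: "ereal s \<le> jump_time f m" unfolding m_def by (rule LeastI_ex)
      with s(1) obtain k where k: "m = Suc k" by (cases m) (auto simp: zero_ereal_def)
      then have lt: "jump_time f k < ereal s"
        using not_less_Least[of k "\<lambda>k. ereal s \<le> jump_time f k"] unfolding m_def by (auto simp: not_le)
      have "k \<le> n"
      proof (rule ccontr)
        assume "\<not> k \<le> n"
        then have "jump_time f (Suc n) \<le> jump_time f k" by (intro jump_time_mono) auto
        with lt s(2) assms(3) show False
          by (meson ereal_less_eq(3) less_le_trans less_trans not_less)
      qed
      have rk: "r k < s" "jump_time f k = ereal (r k)" using lt r[OF \<open>k \<le> n\<close>] by auto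
      have fs: "f s + 1 = f (r k)"
        using lim[OF rk(2,1)] m k s(3) by simp
      have "\<not> ereal s < jump_time f (Suc k)"
        using constant_before_jump[OF rk(2), of s] rk(1) fs by auto
      then have eq: "jump_time f (Suc k) = ereal s" using m k by auto
      then have "k < n" using \<open>k \<le> n\<close> assms(3) s(2) by (cases "k = n") auto
      moreover have "s = r (Suc k)" using eq by (simp add: r_def)
      moreover have "jump_chain f (Suc k) = jump_chain f k - 1"
        using jump_chain_eq[OF eq] jump_chain_eq[OF rk(2)] fs by simp
      ultimately show "s \<in> ?R" by auto
    qed
    show "?R \<subseteq> ?L"
    proof
      fix s assume "s \<in> ?R"
      then obtain k where k: "k < n" "jump_chain f (Suc k) = jump_chain f k - 1" "s = r (Suc k)" by auto
      have J: "jump_time f k = ereal (r k)" "jump_time f (Suc k) = ereal s" "r k < s"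
        using r[of k] r[of "Suc k"] k less[of k] by auto
      have "0 < s" using mono[of 0 "Suc k"] k r0 by simp
      moreover have "s \<le> t"
        using k mono[of "Suc k" n] rn by (cases "Suc k = n") auto
      moreover have "(f \<longlongrightarrow> f s + 1) (at_left s)"
        using lim[OF J(1,3)] J(2) jump_chain_eq[OF J(1)] jump_chain_eq[OF J(2)] k(2) by simp
      ultimately show "s \<in> ?L" by simp
    qed
  qed
  moreover have "inj_on (\<lambda>k. r (Suc k)) ?K"
    proof (rule linorder_inj_onI)
    fix k l assume "k < l" "k \<in> ?K" "l \<in> ?K"
    then show "r (Suc k) \<noteq> r (Suc l)" using mono[of "Suc k" "Suc l"] by auto
  qed auto
  ultimately show ?thesis
    by (simp add: down_jumps_def card_image)
qed

lemma jump_time_eq_sum_holding_time: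
  fixes f :: "real \<Rightarrow> 'a"
  assumes "\<And>k. jump_time f k \<noteq> \<infinity>"
  shows "jump_time f n = ereal (\<Sum>k<n. real_of_ereal (holding_time f k))"
proof (induction n)
  case 0
  then show ?case by (simp add: zero_ereal_def)
next
  case (Suc n)
  then show ?case
    using assms[of "Suc n"] jump_time_nonneg[of f "Suc n"]
    by (cases "jump_time f (Suc n)") (auto simp: holding_time_def)
qed

section \<open>Measurability of the jump times and of the jump chain\<close>

text \<open>
  A right-continuous process can be evaluated at a random time by approximating this time from the
  right by times in a countable grid, where measurability is clear. As the state space is discrete,
  the approximating values are eventually equal to the limit.
\<close>

lemma measurable_at_random_time:
  fixes Z :: "real \<Rightarrow> 'w \<Rightarrow> 'a::{discrete_topology, countable}"
  assumes Z: "\<And>t. t \<ge> 0 \<Longrightarrow> Z t \<in> M \<rightarrow>\<^sub>M count_space UNIV"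
    and cadlag: "\<And>\<omega>. \<omega> \<in> space M \<Longrightarrow> cadlag (\<lambda>t. Z t \<omega>)"
    and R[measurable]: "R \<in> borel_measurable M" and nonneg: "\<And>\<omega>. \<omega> \<in> space M \<Longrightarrow> 0 \<le> R \<omega>"
  shows "(\<lambda>\<omega>. Z (R \<omega>) \<omega>) \<in> M \<rightarrow>\<^sub>M count_space UNIV"
proof -
  \<comment> \<open>the first point of the grid with mesh \<open>1 / (m + 1)\<close> strictly after \<open>R \<omega>\<close>\<close>
  define A where "A m \<omega> = Z (real (Suc (nat \<lfloor>R \<omega> * real (Suc m)\<rfloor>)) / real (Suc m)) \<omega>" for m \<omega>
  have A[measurable]: "A m \<in> M \<rightarrow>\<^sub>M count_space UNIV" for m
    unfolding A_def
    by (rule measurable_compose_countable[where f = "\<lambda>i. Z (real (Suc i) / real (Suc m))"])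
       (auto intro!: Z)
  have ev: "\<forall>\<^sub>F m in sequentially. A m \<omega> = Z (R \<omega>) \<omega>" if \<omega>: "\<omega> \<in> space M" for \<omega>
  proof -
    obtain e where e: "e > R \<omega>" "\<And>s. R \<omega> \<le> s \<Longrightarrow> s < e \<Longrightarrow> Z s \<omega> = Z (R \<omega>) \<omega>"
      using cadlag_right_constant[OF cadlag[OF \<omega>] nonneg[OF \<omega>]] by metis
    obtain N where N: "inverse (real (Suc N)) < e - R \<omega>"
      using reals_Archimedean[of "e - R \<omega>"] e(1) by auto
    have "A m \<omega> = Z (R \<omega>) \<omega>" if "m \<ge> N" for m
    proof -
      let ?c = "real (Suc m)" and ?r = "R \<omega>"
      have c: "?c > 0" by simp
      have fl: "0 \<le> \<lfloor>?r * ?c\<rfloor>" using nonneg[OF \<omega>] by simp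
      have "real (Suc (nat \<lfloor>?r * ?c\<rfloor>)) = of_int \<lfloor>?r * ?c\<rfloor> + 1"
        using fl by simp
      then have b: "?r * ?c \<le> real (Suc (nat \<lfloor>?r * ?c\<rfloor>))" "real (Suc (nat \<lfloor>?r * ?c\<rfloor>)) \<le> ?r * ?c + 1"
        using of_int_floor_le[of "?r * ?c"] floor_correct[of "?r * ?c"] by linarith+
      have "?r \<le> real (Suc (nat \<lfloor>?r * ?c\<rfloor>)) / ?c"
        using b(1) c by (simp add: pos_le_divide_eq)
      moreover have "real (Suc (nat \<lfloor>?r * ?c\<rfloor>)) / ?c \<le> (?r * ?c + 1) / ?c"
        using b(2) c by (intro divide_right_mono) auto
      moreover have "(?r * ?c + 1) / ?c = ?r + inverse ?c"
        using c by (simp add: field_simps)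
      moreover have "inverse ?c \<le> inverse (real (Suc N))"
        using that by (intro le_imp_inverse_le) auto
      ultimately show ?thesis
        unfolding A_def using N by (intro e(2)) linarith+
    qed
    then show ?thesis
      by (auto simp: eventually_sequentially)
  qed
  have iff: "Z (R \<omega>) \<omega> = y \<longleftrightarrow> (\<exists>N. \<forall>m\<ge>N. A m \<omega> = y)" if "\<omega> \<in> space M" for \<omega> y
    using ev[OF that] unfolding eventually_sequentially
    by (metis nat_le_linear)
  have "{\<omega> \<in> space M. Z (R \<omega>) \<omega> = y} = {\<omega> \<in> space M. \<exists>N. \<forall>m\<ge>N. A m \<omega> = y}" for y
    using iff by auto
  also have "\<dots> y \<in> sets M" for y by measurable
  finally show ?thesis
    by (auto simp: measurable_count_space_eq2_countable vimage_def Int_def conj_commute)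
qed

text \<open>
  By right-continuity the path keeps its new value for some time after a jump, so rational times
  suffice to detect a jump. This makes jump times countable infima of measurable functions.
\<close>

lemma jump_time_Suc_eq_INF_rats:
  fixes f :: "real \<Rightarrow> 'a::discrete_topology"
  assumes "cadlag f"
  shows "jump_time f (Suc n) =
    (INF r\<in>\<rat> \<inter> {0..}. if jump_time f n < ereal r \<and> f r \<noteq> f (real_of_ereal (jump_time f n)) then ereal r else \<infinity>)"
    (is "_ = (INF r\<in>_. ?g r)")
proof (rule antisym)
  show "jump_time f (Suc n) \<le> (INF r\<in>\<rat> \<inter> {0..}. ?g r)"
    by (rule INF_greatest) (auto simp: jump_time.simps(2) intro!: Inf_lower)
  show "(INF r\<in>\<rat> \<inter> {0..}. ?g r) \<le> jump_time f (Suc n)"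
    unfolding jump_time.simps(2)
  proof (rule Inf_greatest, clarify, rule dense_ge)
    fix t x assume t: "jump_time f n < ereal t" "f t \<noteq> f (real_of_ereal (jump_time f n))" "ereal t < x"
    have "t \<ge> 0" using jump_time_nonneg[of f n] t(1)
      by (metis ereal_less_eq(5) less_imp_le order.trans)
    then obtain e where e: "e > t" "\<And>s. t \<le> s \<Longrightarrow> s < e \<Longrightarrow> f s = f t"
      using cadlag_right_constant assms by metis
    obtain u where u: "t < u" "ereal u \<le> x"
      using t(3) by (cases x) (auto intro: that[of "t + 1"])
    obtain r where r: "r \<in> \<rat>" "t < r" "r < min e u"
      using Rats_dense_in_real[of t "min e u"] e(1) u(1) by auto
    have "(INF r\<in>\<rat> \<inter> {0..}. ?g r) \<le> ?g r"
      using r \<open>t \<ge> 0\<close> by (intro INF_lower) auto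
    also have "\<dots> = ereal r"
      using less_trans[of "jump_time f n" "ereal t" "ereal r"] t(1,2) e(2)[of r] r by auto
    also have "\<dots> \<le> ereal u" using r(3) by simp
    also have "\<dots> \<le> x" by (rule u(2))
    finally show "(INF r\<in>\<rat> \<inter> {0..}. ?g r) \<le> x" .
  qed
qed

lemma measurable_jump_time:
  fixes Z :: "real \<Rightarrow> 'w \<Rightarrow> 'a::{discrete_topology, countable}"
  assumes Z: "\<And>t. t \<ge> 0 \<Longrightarrow> Z t \<in> M \<rightarrow>\<^sub>M count_space UNIV"
    and cadlag: "\<And>\<omega>. \<omega> \<in> space M \<Longrightarrow> cadlag (\<lambda>t. Z t \<omega>)"
  shows "(\<lambda>\<omega>. jump_time (\<lambda>t. Z t \<omega>) n) \<in> borel_measurable M"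
proof (induction n)
  case 0
  then show ?case by simp
next
  case (Suc n)
  note [measurable] = Suc
  have ZJ[measurable]: "(\<lambda>\<omega>. Z (real_of_ereal (jump_time (\<lambda>t. Z t \<omega>) n)) \<omega>) \<in> M \<rightarrow>\<^sub>M count_space UNIV"
    by (rule measurable_at_random_time[OF Z cadlag]) (auto intro: real_of_ereal_pos jump_time_nonneg)
  have "(\<lambda>\<omega>. INF r\<in>\<rat> \<inter> {0..}. if jump_time (\<lambda>t. Z t \<omega>) n < ereal r \<and>
      Z r \<omega> \<noteq> Z (real_of_ereal (jump_time (\<lambda>t. Z t \<omega>) n)) \<omega> then ereal r else \<infinity>) \<in> borel_measurable M"
  proof (rule borel_measurable_INF)
    show "countable (\<rat> \<inter> {0..} :: real set)" by (simp add: countable_rat)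
    fix r :: real assume "r \<in> \<rat> \<inter> {0..}"
    then have [measurable]: "Z r \<in> M \<rightarrow>\<^sub>M count_space UNIV" by (simp add: Z)
    show "(\<lambda>\<omega>. if jump_time (\<lambda>t. Z t \<omega>) n < ereal r \<and>
      Z r \<omega> \<noteq> Z (real_of_ereal (jump_time (\<lambda>t. Z t \<omega>) n)) \<omega> then ereal r else \<infinity>) \<in> borel_measurable M"
      by measurable
  qed
  then show ?case
    by (rule measurable_cong[THEN iffD1, rotated]) (simp add: jump_time_Suc_eq_INF_rats[OF cadlag])
qed

lemma measurable_jump_chain:
  fixes Z :: "real \<Rightarrow> 'w \<Rightarrow> 'a::{discrete_topology, countable}"
  assumes Z: "\<And>t. t \<ge> 0 \<Longrightarrow> Z t \<in> M \<rightarrow>\<^sub>M count_space UNIV"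
    and cadlag: "\<And>\<omega>. \<omega> \<in> space M \<Longrightarrow> cadlag (\<lambda>t. Z t \<omega>)"
  shows "(\<lambda>\<omega>. jump_chain (\<lambda>t. Z t \<omega>) n) \<in> M \<rightarrow>\<^sub>M count_space UNIV"
proof (induction n)
  case 0
  then show ?case by (simp add: Z)
next
  case (Suc n)
  note [measurable] = Suc measurable_jump_time[OF Z cadlag]
  have [measurable]: "(\<lambda>\<omega>. Z (real_of_ereal (jump_time (\<lambda>t. Z t \<omega>) (Suc n))) \<omega>) \<in> M \<rightarrow>\<^sub>M count_space UNIV"
    by (rule measurable_at_random_time[OF Z cadlag]) (auto intro: real_of_ereal_pos jump_time_nonneg)
  show ?case unfolding jump_chain.simps by measurable
qed

lemma holding_time_pos:
  fixes f :: "real \<Rightarrow> 'a::discrete_topology"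
  assumes "cadlag f"
  shows "0 < holding_time f n"
  using jump_time_less_Suc[OF assms, of n] jump_time_nonneg[of f n] jump_time_mono[of n "Suc n" f]
  by (cases "jump_time f n"; cases "jump_time f (Suc n)") (auto simp: holding_time_def)

lemma jump_time_finite:
  assumes "\<And>k. holding_time f k \<noteq> \<infinity>"
  shows "jump_time f n \<noteq> \<infinity>"
proof (cases n)
  case (Suc k)
  then show ?thesis using assms[of k] by (auto simp: holding_time_def)
qed simp

section \<open>The law of the jump chain together with its holding times\<close>

abbreviation state_time :: "('a \<times> real) measure" where
  "state_time \<equiv> count_space UNIV \<Otimes>\<^sub>M borel"

text \<open>
  In a chain without absorbing states almost every path has only finite holding times, and the
  truncation to real numbers loses nothing.
\<close>

definition history :: "(real \<Rightarrow> 'a) \<Rightarrow> ('a \<times> real) stream" where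
  "history f = to_stream (\<lambda>k. (jump_chain f k, real_of_ereal (holding_time f k)))"

definition history_law :: "'w measure \<Rightarrow> (real \<Rightarrow> 'w \<Rightarrow> 'a) \<Rightarrow> ('a \<times> real) stream measure" where
  "history_law M Z = distr M (stream_space state_time) (\<lambda>\<omega>. history (\<lambda>t. Z t \<omega>))"

text \<open>
  The generators of the product sigma-algebra on states and times for which the holding time law
  gives probabilities: one state, and a holding time beyond a threshold.
\<close>

definition halfline_box :: "'a \<times> real \<Rightarrow> ('a \<times> real) set" where
  "halfline_box p = {fst p} \<times> {snd p<..}"

lemma sets_state_time_eq_sigma:
  "sets (state_time :: ('a::countable \<times> real) measure)
     = sets (sigma (space state_time) (insert {} (range halfline_box)))"
    (is "sets ?S = sets (sigma _ ?G)")
proof (rule antisym)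
  have sp: "space ?S = UNIV" by (simp add: space_pair_measure)
  have G: "halfline_box p \<in> sets (sigma UNIV ?G)" for p :: "'a \<times> real"
    by (auto intro: sigma_sets.Basic)
  have "fst \<in> sigma UNIV ?G \<rightarrow>\<^sub>M count_space UNIV"
  proof -
    have eq: "(fst :: 'a \<times> real \<Rightarrow> 'a) -` {y} = (\<Union>n::nat. halfline_box (y, - real n))" for y
      by (auto simp: halfline_box_def) (metis reals_Archimedean2 minus_less_iff)
    have "(fst :: 'a \<times> real \<Rightarrow> 'a) -` {y} \<in> sets (sigma UNIV ?G)" for y
      unfolding eq by (intro sets.countable_UN image_subsetI G)
    then show ?thesis by (auto simp: measurable_count_space_eq2_countable)
  qed
  moreover have "snd \<in> sigma UNIV ?G \<rightarrow>\<^sub>M borel"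
  proof -
    have "{p :: 'a \<times> real. s < snd p} = (\<Union>y. halfline_box (y, s))" for s
      by (auto simp: halfline_box_def)
    moreover have "(\<Union>y. halfline_box (y, s)) \<in> sets (sigma UNIV ?G)" for s :: real
      using G by (intro sets.countable_UN') (auto simp: countableI_type)
    ultimately show ?thesis by (auto simp: borel_measurable_iff_greater)
  qed
  ultimately have "(\<lambda>p. (fst p, snd p)) \<in> sigma UNIV ?G \<rightarrow>\<^sub>M ?S"
    by (rule measurable_Pair)
  then have "(\<lambda>p. p) \<in> sigma UNIV ?G \<rightarrow>\<^sub>M ?S"
    by simp
  then show "sets ?S \<subseteq> sets (sigma (space ?S) ?G)"
    unfolding sp by (intro subsetI) (drule measurable_sets, auto)
  have "?G \<subseteq> sets ?S"
    by (auto simp: halfline_box_def)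
  then show "sets (sigma (space ?S) ?G) \<subseteq> sets ?S"
    by (simp add: sp sets.sigma_sets_subset[of _ ?S, unfolded sp])
qed

text \<open>
  The maximum with \<open>0\<close> extends the usual formula to all real thresholds, as needed for a generator of
  the Borel sets.
\<close>

lemma emeasure_exponential_gt:
  assumes "0 < l"
  shows "emeasure (density lborel (exponential_density l)) {s<..} = ennreal (exp (- l * max 0 s))"
proof -
  let ?E = "density lborel (exponential_density l)"
  interpret prob_space ?E by (rule prob_space_exponential_density) fact
  have D: "distributed ?E lborel (\<lambda>x. x) (exponential_density l)"
    unfolding distributed_def by (simp add: distr_id2 assms exponential_density_nonneg)
  have gt: "prob {x. a < x} = exp (- a * l)" if "0 \<le> a" for a
    using exponential_distributedD_gt[OF D that assms] by (simp add: space_density)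
  show ?thesis
  proof (cases "s \<ge> 0")
    case True
    then show ?thesis using gt[OF True] by (simp add: emeasure_eq_measure greaterThan_def mult.commute)
  next
    case False
    then have "prob {0<..} \<le> prob {s<..}"
      by (intro finite_measure_mono) auto
    moreover have "prob {0<..} = 1" using gt[of 0] by (simp add: greaterThan_def)
    ultimately have "prob {s<..} = 1" using prob_le_1[of "{s<..}"] by simp
    with False show ?thesis by (simp add: emeasure_eq_measure)
  qed
qed

lemma scylinder_UNIV_iff:
  "x \<in> scylinder UNIV As \<longleftrightarrow> (\<forall>i<length As. x !! i \<in> As ! i)"
proof (induction As arbitrary: x)
  case (Cons A As)
  then show ?case
    by (auto simp: less_Suc_eq_0_disj)
qed simp

lemma history_nth_in_halfline_box:
  "history f !! k \<in> halfline_box p \<longleftrightarrow> jump_chain f k = fst p \<and> snd p < real_of_ereal (holding_time f k)"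
  by (cases p) (auto simp: history_def to_stream_def halfline_box_def)

text \<open>
  A chain without absorbing states: all its holding times are exponential, hence finite almost surely.
\<close>

locale countable_ctmc = ctmc M Q x Z
  for M :: "'w measure" and Q :: "'a::{discrete_topology,countable} \<Rightarrow> 'a \<Rightarrow> real" and x Z +
  assumes rate_pos: "\<And>y. Q y y < 0"
begin

lemma measurable_jump_time'[measurable]: "(\<lambda>\<omega>. jump_time (\<lambda>t. Z t \<omega>) n) \<in> borel_measurable M"
  by (rule measurable_jump_time[OF measurable_Z cadlag_paths])

lemma measurable_jump_chain'[measurable]: "(\<lambda>\<omega>. jump_chain (\<lambda>t. Z t \<omega>) n) \<in> M \<rightarrow>\<^sub>M count_space UNIV"
  by (rule measurable_jump_chain[OF measurable_Z cadlag_paths])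

lemma measurable_holding_time[measurable]: "(\<lambda>\<omega>. holding_time (\<lambda>t. Z t \<omega>) n) \<in> borel_measurable M"
  unfolding holding_time_def by measurable

lemma measurable_history: "(\<lambda>\<omega>. history (\<lambda>t. Z t \<omega>)) \<in> M \<rightarrow>\<^sub>M stream_space state_time"
  unfolding history_def by (rule measurable_stream_space2) (simp add: to_stream_def)

text \<open>
  The probability that the jump chain starts with a prescribed segment and that the last holding time
  of the segment exceeds \<open>m\<close> is at most \<open>exp (- rate * m)\<close>, which tends to \<open>0\<close>; there are only countably many
  segments.
\<close>

lemma AE_holding_time_finite: "AE \<omega> in M. \<forall>k. holding_time (\<lambda>t. Z t \<omega>) k \<noteq> \<infinity>"
proof (subst AE_all_countable, rule allI)
  fix n
  have "AE \<omega> in M. \<not> ((\<forall>k\<le>n. jump_chain (\<lambda>t. Z t \<omega>) k = ys ! k) \<and> holding_time (\<lambda>t. Z t \<omega>) n = \<infinity>)"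
    for ys :: "'a list"
  proof -
    let ?A = "{\<omega> \<in> space M. (\<forall>k\<le>n. jump_chain (\<lambda>t. Z t \<omega>) k = ys ! k) \<and> holding_time (\<lambda>t. Z t \<omega>) n = \<infinity>}"
    have le: "prob ?A \<le> exp (Q (ys ! n) (ys ! n) * real m)" for m :: nat
    proof -
      \<comment> \<open>the threshold \<open>0\<close> is exceeded by every holding time, so only the last one is constrained\<close>
      let ?s = "\<lambda>k. if k = n then real m else 0"
      have "prob ?A \<le> \<P>(\<omega> in M. \<forall>k\<le>n. jump_chain (\<lambda>t. Z t \<omega>) k = ys ! k \<and> holding_time (\<lambda>t. Z t \<omega>) k > ?s k)"
        using holding_time_pos[OF cadlag_paths]
        by (intro finite_measure_mono) (auto simp: zero_ereal_def)
      also have "\<dots> = \<P>(\<omega> in M. \<forall>k\<le>n. jump_chain (\<lambda>t. Z t \<omega>) k = ys ! k)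
            * (\<Prod>k\<le>n. exp (Q (ys ! k) (ys ! k) * ?s k))"
        by (rule holding_time_law) simp
      also have "\<dots> \<le> 1 * (\<Prod>k\<le>n. exp (Q (ys ! k) (ys ! k) * ?s k))"
        by (intro mult_right_mono) (auto intro: prod_nonneg)
      also have "(\<Prod>k\<le>n. exp (Q (ys ! k) (ys ! k) * ?s k)) = (\<Prod>k\<le>n. if k = n then exp (Q (ys ! n) (ys ! n) * real m) else 1)"
        by (intro prod.cong) auto
      finally show ?thesis by simp
    qed
    have "(\<lambda>m. exp (Q (ys ! n) (ys ! n)) ^ m) \<longlonglongrightarrow> 0"
      using rate_pos by (intro LIMSEQ_power_zero) simp
    then have "(\<lambda>m. exp (Q (ys ! n) (ys ! n) * real m)) \<longlonglongrightarrow> 0"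
      by (simp add: exp_of_nat2_mult)
    then have "prob ?A \<le> 0"
      by (rule LIMSEQ_le_const) (use le in auto)
    then have "prob ?A = 0"
      using measure_nonneg[of M ?A] by linarith
    then show ?thesis
      by (auto simp: AE_iff_measurable[OF _ refl] emeasure_eq_measure)
  qed
  then have "AE \<omega> in M. \<forall>ys. \<not> ((\<forall>k\<le>n. jump_chain (\<lambda>t. Z t \<omega>) k = ys ! k) \<and> holding_time (\<lambda>t. Z t \<omega>) n = \<infinity>)"
    by (subst AE_all_countable) blast
  then show "AE \<omega> in M. holding_time (\<lambda>t. Z t \<omega>) n \<noteq> \<infinity>"
  proof eventually_elim
    case (elim \<omega>)
    show ?case
      using elim[rule_format, of "map (jump_chain (\<lambda>t. Z t \<omega>)) [0..<Suc n]"]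
      by (auto simp del: upt_Suc)
  qed
qed

text \<open>
  Holding times are positive on every path and finite on almost every path, so negative thresholds may be replaced
  by \<open>0\<close> and the truncation to real numbers is harmless.
\<close>

lemma prob_history_cylinder:
  assumes "zs \<noteq> []"
  shows "prob {\<omega> \<in> space M. \<forall>k<length zs. history (\<lambda>t. Z t \<omega>) !! k \<in> halfline_box (zs ! k)}
    = of_bool (fst (zs ! 0) = x)
      * (\<Prod>k<length zs - 1. jump_prob Q (fst (zs ! k)) (fst (zs ! Suc k)))
      * (\<Prod>k<length zs. exp (Q (fst (zs ! k)) (fst (zs ! k)) * max 0 (snd (zs ! k))))"
proof -
  obtain n where n: "length zs = Suc n" using assms by (cases zs) auto
  have "prob {\<omega> \<in> space M. \<forall>k<length zs. history (\<lambda>t. Z t \<omega>) !! k \<in> halfline_box (zs ! k)}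
    = \<P>(\<omega> in M. \<forall>k\<le>n. jump_chain (\<lambda>t. Z t \<omega>) k = fst (zs ! k) \<and> holding_time (\<lambda>t. Z t \<omega>) k > max 0 (snd (zs ! k)))"
  proof (rule measure_eq_AE)
    show "AE \<omega> in M. \<omega> \<in> {\<omega> \<in> space M. \<forall>k<length zs. history (\<lambda>t. Z t \<omega>) !! k \<in> halfline_box (zs ! k)}
      \<longleftrightarrow> \<omega> \<in> {\<omega> \<in> space M. \<forall>k\<le>n. jump_chain (\<lambda>t. Z t \<omega>) k = fst (zs ! k) \<and> holding_time (\<lambda>t. Z t \<omega>) k > max 0 (snd (zs ! k))}"
      using AE_holding_time_finite AE_space
    proof eventually_elim
      case (elim \<omega>)
      have "snd (zs ! k) < real_of_ereal (holding_time (\<lambda>t. Z t \<omega>) k) \<longleftrightarrow>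
        ereal (max 0 (snd (zs ! k))) < holding_time (\<lambda>t. Z t \<omega>) k" for k
        using elim(1) holding_time_pos[OF cadlag_paths[OF elim(2)], of k]
        by (cases "holding_time (\<lambda>t. Z t \<omega>) k") (auto simp: max_def)
      then show ?case
        using n by (simp add: history_nth_in_halfline_box less_Suc_eq_le)
    qed
  qed (unfold history_nth_in_halfline_box, measurable)
  also have "\<dots> = \<P>(\<omega> in M. \<forall>k\<le>n. jump_chain (\<lambda>t. Z t \<omega>) k = fst (zs ! k))
            * (\<Prod>k\<le>n. exp (Q (fst (zs ! k)) (fst (zs ! k)) * max 0 (snd (zs ! k))))"
    by (rule holding_time_law[of n "\<lambda>k. max 0 (snd (zs ! k))" "\<lambda>k. fst (zs ! k)"]) simp
  finally show ?thesis
    unfolding jump_chain_law using n by (simp add: lessThan_Suc_atMost)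
qed

lemma prob_space_history_law: "prob_space (history_law M Z)"
  unfolding history_law_def by (rule prob_space_distr[OF measurable_history])

lemma sets_history_law[measurable_cong]: "sets (history_law M Z) = sets (stream_space state_time)"
  by (simp add: history_law_def)

lemma space_history_law: "space (history_law M Z) = UNIV"
  by (simp add: history_law_def space_stream_space space_pair_measure)

lemma emeasure_history_law_cylinder:
  assumes "zs \<noteq> []"
  shows "emeasure (history_law M Z) (scylinder UNIV (map halfline_box zs))
    = ennreal (of_bool (fst (zs ! 0) = x)
      * (\<Prod>k<length zs - 1. jump_prob Q (fst (zs ! k)) (fst (zs ! Suc k)))
      * (\<Prod>k<length zs. exp (Q (fst (zs ! k)) (fst (zs ! k)) * max 0 (snd (zs ! k)))))"
proof -
  have "scylinder (space state_time) (map halfline_box zs) \<in> sets (stream_space state_time)"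
    by (rule sets_scylinder) (auto simp: halfline_box_def)
  then have "emeasure (history_law M Z) (scylinder UNIV (map halfline_box zs))
    = emeasure M {\<omega> \<in> space M. history (\<lambda>t. Z t \<omega>) \<in> scylinder UNIV (map halfline_box zs)}"
    unfolding history_law_def
    by (subst emeasure_distr[OF measurable_history])
       (auto simp: space_pair_measure vimage_def Int_def conj_commute)
  also have "\<dots> = prob {\<omega> \<in> space M. \<forall>k<length zs. history (\<lambda>t. Z t \<omega>) !! k \<in> halfline_box (zs ! k)}"
    by (simp add: emeasure_eq_measure scylinder_UNIV_iff)
  also note prob_history_cylinder[OF assms]
  finally show ?thesis .
qed

end

section \<open>First-step decomposition of the law of the history\<close>

abbreviation exponential_law :: "real \<Rightarrow> real measure" where
  "exponential_law l \<equiv> density lborel (exponential_density l)"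

lemma scylinder_first_step:
  "(\<lambda>(s, h). (x, s) ## h) -` scylinder UNIV (map halfline_box (z # zs))
    = (if fst z = x then {snd z<..} else {}) \<times> scylinder UNIV (map halfline_box zs)"
  by (auto simp: halfline_box_def)

text \<open>
  The same chain started from every state, each copy on its own probability space. The jump
  probabilities are given as a probability mass function so that they can be used as a kernel.
\<close>

locale ctmc_family =
  fixes M :: "'a::{discrete_topology,countable} \<Rightarrow> 'w measure" and Q :: "'a \<Rightarrow> 'a \<Rightarrow> real"
    and Z :: "'a \<Rightarrow> real \<Rightarrow> 'w \<Rightarrow> 'a" and K :: "'a \<Rightarrow> 'a pmf"
  assumes chain: "\<And>x. countable_ctmc (M x) Q x (Z x)"
    and pmf_K: "\<And>x y. pmf (K x) y = jump_prob Q x y"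
begin

abbreviation H :: "'a \<Rightarrow> ('a \<times> real) stream measure" where
  "H x \<equiv> history_law (M x) (Z x)"

abbreviation E :: "'a \<Rightarrow> real measure" where
  "E x \<equiv> exponential_law (- Q x x)"

text \<open>
  The law of a history that waits in \<open>x\<close> for an exponential time and then continues like a fresh
  history started in \<open>y\<close>.
\<close>

abbreviation step :: "'a \<Rightarrow> 'a \<Rightarrow> ('a \<times> real) stream measure" where
  "step x y \<equiv> distr (E x \<Otimes>\<^sub>M H y) (stream_space state_time) (\<lambda>(s, h). (x, s) ## h)"

lemma rate_pos: "- Q x x > 0"
  using countable_ctmc.rate_pos[OF chain] by simp

lemma prob_space_E: "prob_space (E x)"
  by (rule prob_space_exponential_density[OF rate_pos])

lemma prob_space_H: "prob_space (H x)"
  by (rule countable_ctmc.prob_space_history_law[OF chain])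

lemma sets_H [measurable_cong]: "sets (H x) = sets (stream_space state_time)"
  by (rule countable_ctmc.sets_history_law[OF chain])

lemma space_H: "space (H x) = UNIV"
  by (rule countable_ctmc.space_history_law[OF chain])

lemma measurable_cons: "(\<lambda>(s, h). (x, s) ## h) \<in> E x \<Otimes>\<^sub>M H y \<rightarrow>\<^sub>M stream_space state_time"
proof -
  have "(\<lambda>(s, h). (x, s) ## h) \<in> borel \<Otimes>\<^sub>M stream_space state_time \<rightarrow>\<^sub>M stream_space state_time"
    by measurable
  also have "borel \<Otimes>\<^sub>M stream_space state_time \<rightarrow>\<^sub>M stream_space state_time = E x \<Otimes>\<^sub>M H y \<rightarrow>\<^sub>M stream_space state_time"
    by (intro measurable_cong_sets sets_pair_measure_cong) (auto simp: sets_H)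
  finally show ?thesis .
qed

lemma prob_space_step: "prob_space (step x y)"
proof -
  interpret E: prob_space "E x" by (rule prob_space_E)
  interpret H: prob_space "H y" by (rule prob_space_H)
  interpret EH: pair_prob_space "E x" "H y" ..
  show ?thesis by (rule EH.prob_space_distr[OF measurable_cons])
qed

lemma measurable_step: "step x \<in> measure_pmf (K x) \<rightarrow>\<^sub>M subprob_algebra (stream_space state_time)"
  by (auto simp: space_subprob_algebra prob_space_step prob_space_imp_subprob_space)

text \<open>
  This is the Markov property at the first jump. Both sides are probability measures on streams, so
  it suffices to compare them on cylinders over \<open>halfline_box\<close>. There each side is a product of jump
  probabilities and exponential factors, and prepending a state multiplies it by one factor of
  each kind.
\<close>

lemma H_eq_bind_step: "H x = measure_pmf (K x) \<bind> step x"
proof (rule stream_space_eq_scylinder)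
  interpret E: prob_space "E x" by (rule prob_space_E)
  show "prob_space (H x)" by (rule prob_space_H)
  show "prob_space (measure_pmf (K x) \<bind> step x)"
    by (rule measure_pmf.prob_space_bind[OF _ measurable_step]) (simp add: prob_space_step)
  show "Int_stable (insert {} (range (halfline_box :: 'a \<times> real \<Rightarrow> _)))"
  proof (rule Int_stableI)
    fix A B :: "('a \<times> real) set"
    assume A: "A \<in> insert {} (range halfline_box)" and B: "B \<in> insert {} (range halfline_box)"
    have int: "halfline_box p \<inter> halfline_box p' \<in> insert {} (range halfline_box)" for p p' :: "'a \<times> real"
    proof (cases "fst p = fst p'")
      case True
      then have "halfline_box p \<inter> halfline_box p' = halfline_box (fst p, max (snd p) (snd p'))"
        by (auto simp: halfline_box_def)
      then show ?thesis by simp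
    next
      case False
      then have "halfline_box p \<inter> halfline_box p' = {}" by (auto simp: halfline_box_def)
      then show ?thesis by simp
    qed
    from A B show "A \<inter> B \<in> insert {} (range halfline_box)"
    proof (elim insertE rangeE)
      fix p p' assume "A = halfline_box p" "B = halfline_box p'"
      then show ?thesis using int by simp
    qed auto
  qed
  show "sets (state_time :: ('a \<times> real) measure) = sets (sigma (space state_time) (insert {} (range halfline_box)))"
    by (rule sets_state_time_eq_sigma)
  let ?C = "range (\<lambda>(y, n). halfline_box (y :: 'a, - real n))"
  show "countable ?C" by (intro countable_image countableI_type)
  show "?C \<subseteq> insert {} (range halfline_box)" by auto
  have "\<exists>n. - real n < s" for s
    using reals_Archimedean2[of "- s"] by (auto simp: minus_less_iff)
  then show "\<Union>?C = space state_time"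
    by (auto simp: space_pair_measure halfline_box_def)
  show "insert {} (range halfline_box) \<subseteq> Pow (space (state_time :: ('a \<times> real) measure))"
    by (auto simp: space_pair_measure)
  show "sets (H x) = sets (stream_space state_time)" by (rule sets_H)
  show "sets (measure_pmf (K x) \<bind> step x) = sets (stream_space state_time)"
    by (rule sets_bind) auto
  fix xs :: "('a \<times> real) set list"
  assume xs: "xs \<noteq> []" "xs \<in> lists (insert {} (range halfline_box))"
  have sp: "space (state_time :: ('a \<times> real) measure) = UNIV" by (simp add: space_pair_measure)
  show "emeasure (H x) (scylinder (space state_time) xs) =
      emeasure (measure_pmf (K x) \<bind> step x) (scylinder (space state_time) xs)"
  proof (cases "{} \<in> set xs")
    case True
    then have "scylinder UNIV xs = {}"
      by (auto simp: scylinder_UNIV_iff in_set_conv_nth) (metis empty_iff)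
    then show ?thesis by (simp add: sp)
  next
    case False
    with xs(2) have "\<exists>zs. xs = map halfline_box zs"
      unfolding ex_map_conv by (auto simp: image_iff)
    with xs(1) obtain z zs where zs: "xs = map halfline_box (z # zs)"
      by (metis list.exhaust list.map_disc_iff)
    let ?B = "\<lambda>zs. scylinder UNIV (map halfline_box zs) :: ('a \<times> real) stream set"
    have B[measurable]: "?B zs \<in> sets (stream_space state_time)" for zs
      using sets_scylinder[of "map halfline_box zs" state_time]
      by (auto simp: sp halfline_box_def)
    have Ny: "emeasure (step x y) (?B (z # zs)) = ennreal (of_bool (fst z = x) * exp (Q x x * max 0 (snd z))) * emeasure (H y) (?B zs)" for y
    proof -
      interpret H: prob_space "H y" by (rule prob_space_H)
      have "emeasure (step x y) (?B (z # zs)) = emeasure (E x \<Otimes>\<^sub>M H y) ((if fst z = x then {snd z<..} else {}) \<times> ?B zs)"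
        using B[of "z # zs"] by (subst emeasure_distr[OF measurable_cons])
          (simp_all only: scylinder_first_step space_pair_measure,
           simp add: space_H)
      also have "\<dots> = emeasure (E x) (if fst z = x then {snd z<..} else {}) * emeasure (H y) (?B zs)"
        by (intro H.emeasure_pair_measure_Times) auto
      also have "emeasure (E x) (if fst z = x then {snd z<..} else {}) = ennreal (of_bool (fst z = x) * exp (Q x x * max 0 (snd z)))"
        using emeasure_exponential_gt[OF rate_pos[of x], of "snd z"] by simp
      finally show ?thesis .
    qed
    have "emeasure (measure_pmf (K x) \<bind> step x) (?B (z # zs)) =
        (\<integral>\<^sup>+y. emeasure (step x y) (?B (z # zs)) \<partial>measure_pmf (K x))"
      by (rule emeasure_bind[OF _ measurable_step B]) simp
    also have "\<dots> = ennreal (of_bool (fst z = x) * exp (Q x x * max 0 (snd z))) * (\<integral>\<^sup>+y. emeasure (H y) (?B zs) \<partial>measure_pmf (K x))"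
      unfolding Ny by (rule nn_integral_cmult) simp
    also have "\<dots> = emeasure (H x) (?B (z # zs))"
    proof (cases zs)
      case Nil
      have "emeasure (H y) UNIV = 1" for y
        using prob_space.emeasure_space_1[OF prob_space_H, of y] space_H[of y] by simp
      then show ?thesis
        using countable_ctmc.emeasure_history_law_cylinder[OF chain, of "[z]" x] Nil
        by (cases "fst z = x") (auto simp: space_stream_space[symmetric] sp)
    next
      case (Cons z' zs')
      let ?W = "(\<Prod>k<length zs - 1. jump_prob Q (fst (zs ! k)) (fst (zs ! Suc k)))
        * (\<Prod>k<length zs. exp (Q (fst (zs ! k)) (fst (zs ! k)) * max 0 (snd (zs ! k))))"
      have jp: "jump_prob Q y y' \<ge> 0" for y y' using pmf_K[of y y'] pmf_nonneg[of "K y" y'] by simp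
      have W: "?W \<ge> 0" by (intro mult_nonneg_nonneg prod_nonneg) (auto simp: jp)
      have "emeasure (H y) (?B zs) = ennreal (of_bool (fst (zs ! 0) = y) * ?W)" for y
        using countable_ctmc.emeasure_history_law_cylinder[OF chain, of zs y] Cons
        by (simp only: mult.assoc list.distinct not_False_eq_True simp_thms)
      then have "emeasure (H y) (?B zs) = ennreal ?W * indicator {fst z'} y" for y
        using Cons by (auto split: split_indicator)
      then have "(\<integral>\<^sup>+y. emeasure (H y) (?B zs) \<partial>measure_pmf (K x)) = ennreal ?W * ennreal (jump_prob Q x (fst z'))"
        by (simp add: nn_integral_cmult_indicator emeasure_pmf_single pmf_K)
      moreover have "emeasure (H x) (?B (z # zs)) = ennreal (of_bool (fst z = x) * exp (Q x x * max 0 (snd z)) * (?W * jump_prob Q x (fst z')))"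
      proof -
        have len: "length (z # zs) - 1 = Suc (length zs - 1)" "length (z # zs) = Suc (length zs)"
          using Cons by simp_all
        have 1: "(\<Prod>k<length (z # zs) - 1. jump_prob Q (fst ((z # zs) ! k)) (fst ((z # zs) ! Suc k)))
          = jump_prob Q (fst z) (fst z') * (\<Prod>k<length zs - 1. jump_prob Q (fst (zs ! k)) (fst (zs ! Suc k)))"
          unfolding len(1) prod.lessThan_Suc_shift nth_Cons_0 nth_Cons_Suc
          using Cons by simp
        have 2: "(\<Prod>k<length (z # zs). exp (Q (fst ((z # zs) ! k)) (fst ((z # zs) ! k)) * max 0 (snd ((z # zs) ! k))))
          = exp (Q (fst z) (fst z) * max 0 (snd z))
            * (\<Prod>k<length zs. exp (Q (fst (zs ! k)) (fst (zs ! k)) * max 0 (snd (zs ! k))))"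
          unfolding len(2) prod.lessThan_Suc_shift nth_Cons_0 nth_Cons_Suc ..
        show ?thesis
          using countable_ctmc.emeasure_history_law_cylinder[OF chain, of "z # zs" x]
          unfolding 1 2 by (cases "fst z = x") (simp_all del: scylinder.simps list.map add: ac_simps)
      qed
      moreover have a: "0 \<le> of_bool (fst z = x) * exp (Q x x * max 0 (snd z))" by simp
      ultimately show ?thesis
        by (simp only: ennreal_mult[OF a mult_nonneg_nonneg[OF W jp]] ennreal_mult[OF W jp])
    qed
    finally show ?thesis unfolding zs sp by simp
  qed
qed

lemma emeasure_H_first_step:
  assumes X: "X \<in> sets (stream_space state_time)"
  shows "emeasure (H x) X =
    (\<integral>\<^sup>+y. \<integral>\<^sup>+s. emeasure (H y) {h. (x, s) ## h \<in> X} \<partial>E x \<partial>measure_pmf (K x))"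
proof -
  have step: "emeasure (step x y) X = (\<integral>\<^sup>+s. emeasure (H y) {h. (x, s) ## h \<in> X} \<partial>E x)" for y
  proof -
    interpret H: prob_space "H y" by (rule prob_space_H)
    let ?X = "(\<lambda>(s, h). (x, s) ## h) -` X \<inter> space (E x \<Otimes>\<^sub>M H y)"
    have "emeasure (step x y) X = emeasure (E x \<Otimes>\<^sub>M H y) ?X"
      by (rule emeasure_distr[OF measurable_cons X])
    also have "\<dots> = (\<integral>\<^sup>+s. emeasure (H y) (Pair s -` ?X) \<partial>E x)"
      by (rule H.emeasure_pair_measure_alt[OF measurable_sets[OF measurable_cons X]])
    also have "(\<lambda>s. Pair s -` ?X) = (\<lambda>s. {h. (x, s) ## h \<in> X})"
      by (auto simp: space_pair_measure space_H)
    finally show ?thesis .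
  qed
  have "emeasure (H x) X = emeasure (measure_pmf (K x) \<bind> step x) X"
    by (simp only: H_eq_bind_step[symmetric])
  also have "\<dots> = (\<integral>\<^sup>+y. emeasure (step x y) X \<partial>measure_pmf (K x))"
    by (rule emeasure_bind[OF _ measurable_step X]) simp
  finally show ?thesis unfolding step .
qed

end

section \<open>Position and number of downward jumps as functions of the history\<close>

definition arrival :: "('a \<times> real) stream \<Rightarrow> nat \<Rightarrow> real" where
  "arrival h n = (\<Sum>k<n. snd (h !! k))"

definition downs :: "(int \<times> real) stream \<Rightarrow> nat \<Rightarrow> nat" where
  "downs h n = card {k. k < n \<and> fst (h !! Suc k) = fst (h !! k) - 1}"

text \<open>
  The existential form, instead of a choice of the number of jumps until time \<open>t\<close>, makes the
  recursion \<open>ends_in_Stream\<close> true for every stream, including those whose arrival times do not tend to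
  infinity.
\<close>

definition ends_in :: "(nat \<times> int) set \<Rightarrow> real \<Rightarrow> (int \<times> real) stream \<Rightarrow> bool" where
  "ends_in A t h \<longleftrightarrow> (\<exists>n. arrival h n \<le> t \<and> t < arrival h (Suc n) \<and> (downs h n, fst (h !! n)) \<in> A)"

text \<open>
  What remains to be achieved once a downward jump has been made.
\<close>

definition after_down :: "(nat \<times> int) set \<Rightarrow> (nat \<times> int) set" where
  "after_down A = {(d, z). (Suc d, z) \<in> A}"

lemma down_jumps_history:
  fixes f :: "real \<Rightarrow> int"
  assumes "cadlag f" "t \<ge> 0" "\<And>k. holding_time f k \<noteq> \<infinity>"
  shows "(down_jumps f t, f t) \<in> A \<longleftrightarrow> ends_in A t (history f)"
proof -
  have J: "jump_time f n = ereal (arrival (history f) n)" for n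
    using jump_time_eq_sum_holding_time[OF jump_time_finite[OF assms(3)]]
    by (simp add: arrival_def history_def to_stream_def)
  have Y: "fst (history f !! n) = jump_chain f n" for n
    by (simp add: history_def to_stream_def)
  have eq: "(down_jumps f t, f t) = (downs (history f) n, fst (history f !! n))"
    if "arrival (history f) n \<le> t" "t < arrival (history f) (Suc n)" for n
    using that down_jumps_eq[OF assms(1), of n t] jump_chain_at[of f n t]
    unfolding J Y downs_def by simp
  obtain n where "jump_time f n \<le> ereal t" "ereal t < jump_time f (Suc n)"
    using jump_interval_exists[OF assms(1,2)] by blast
  then show ?thesis
    unfolding ends_in_def J using eq by auto metis+
qed

lemma arrival_Stream: "arrival (p ## h) (Suc n) = snd p + arrival h n"
  unfolding arrival_def sum.lessThan_Suc_shift by simp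

lemma downs_Stream: "downs (p ## h) (Suc n) = of_bool (fst (shd h) = fst p - 1) + downs h n"
proof -
  have "{k. k < Suc n \<and> fst ((p ## h) !! Suc k) = fst ((p ## h) !! k) - 1}
    = {k. k = 0 \<and> fst (shd h) = fst p - 1} \<union> Suc ` {k. k < n \<and> fst (h !! Suc k) = fst (h !! k) - 1}"
    (is "?L = ?A \<union> ?B")
    by (auto simp: less_Suc_eq_0_disj image_iff)
  moreover have "card (?A \<union> ?B) = card ?A + card ?B"
    by (intro card_Un_disjoint) auto
  moreover have "card ?B = downs h n"
    by (simp add: downs_def card_image)
  moreover have "card ?A = of_bool (fst (shd h) = fst p - 1)"
    by (cases "fst (shd h) = fst p - 1") auto
  ultimately show ?thesis unfolding downs_def by simp
qed

text \<open>
  Either no jump occurs until time \<open>t\<close>, or the target is reached by the remaining history in the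
  remaining time, where a first jump downwards is accounted for by \<open>after_down\<close>.
\<close>

lemma ends_in_Stream:
  "ends_in A t ((a, s) ## h) \<longleftrightarrow>
    0 \<le> t \<and> t < s \<and> (0, a) \<in> A \<or>
    ends_in (if fst (shd h) = a - 1 then after_down A else A) (t - s) h"
proof -
  have ex: "(\<exists>n. P n) \<longleftrightarrow> P 0 \<or> (\<exists>n. P (Suc n))" for P :: "nat \<Rightarrow> bool"
    by (metis not0_implies_Suc)
  have "ends_in A t ((a, s) ## h) \<longleftrightarrow>
    (arrival ((a, s) ## h) 0 \<le> t \<and> t < arrival ((a, s) ## h) (Suc 0) \<and> (downs ((a, s) ## h) 0, a) \<in> A) \<or>
    (\<exists>n. arrival ((a, s) ## h) (Suc n) \<le> t \<and> t < arrival ((a, s) ## h) (Suc (Suc n))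
      \<and> (downs ((a, s) ## h) (Suc n), fst (h !! n)) \<in> A)"
    unfolding ends_in_def by (subst ex) simp
  also have "\<dots> \<longleftrightarrow> 0 \<le> t \<and> t < s \<and> (0, a) \<in> A \<or>
    ends_in (if fst (shd h) = a - 1 then after_down A else A) (t - s) h"
    unfolding arrival_Stream downs_Stream ends_in_def after_down_def
    by (auto simp: arrival_def downs_def algebra_simps)
  finally show ?thesis .
qed

lemma not_ends_in_neg:
  assumes "\<And>k. 0 \<le> snd (h !! k)" "t < 0"
  shows "\<not> ends_in A t h"
  using assms(2) sum_nonneg[of "{..<n}" "\<lambda>k. snd (h !! k)" for n] assms(1)
  unfolding ends_in_def arrival_def by (meson not_le order_trans)

lemma measurable_downs [measurable]:
  "(\<lambda>h. downs h n) \<in> stream_space state_time \<rightarrow>\<^sub>M count_space UNIV"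
  unfolding downs_def by measurable

lemma measurable_arrival [measurable]:
  "(\<lambda>h. arrival h n) \<in> borel_measurable (stream_space (state_time :: ('a \<times> real) measure))"
  unfolding arrival_def by measurable

lemma measurable_ends_in [measurable]:
  "Measurable.pred (borel \<Otimes>\<^sub>M stream_space state_time) (\<lambda>(t, h). ends_in A t h)"
proof -
  have eq: "ends_in A t h \<longleftrightarrow> (\<exists>n d z. arrival h n \<le> t \<and> t < arrival h (Suc n) \<and> d = downs h n \<and> z = fst (h !! n) \<and> (d, z) \<in> A)" for t h
    unfolding ends_in_def by blast
  show ?thesis
    unfolding eq split_beta' by measurable
qed

lemma measurable_ends_in_fixed_time [measurable]:
  "Measurable.pred (stream_space state_time) (ends_in A t)"
proof -
  have "(\<lambda>h. (t, h)) \<in> stream_space state_time \<rightarrow>\<^sub>M borel \<Otimes>\<^sub>M stream_space state_time"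
    by measurable
  from measurable_compose[OF this measurable_ends_in] show ?thesis by simp
qed

lemma measurable_down_jumps:
  fixes Z :: "real \<Rightarrow> 'w \<Rightarrow> int"
  assumes Z: "\<And>t. t \<ge> 0 \<Longrightarrow> Z t \<in> M \<rightarrow>\<^sub>M count_space UNIV"
    and cadlag: "\<And>\<omega>. \<omega> \<in> space M \<Longrightarrow> cadlag (\<lambda>t. Z t \<omega>)"
    and t: "t \<ge> 0"
  shows "(\<lambda>\<omega>. down_jumps (\<lambda>s. Z s \<omega>) t) \<in> M \<rightarrow>\<^sub>M count_space UNIV"
proof -
  note [measurable] = measurable_jump_time[OF Z cadlag] measurable_jump_chain[OF Z cadlag]
  have "{\<omega> \<in> space M. down_jumps (\<lambda>s. Z s \<omega>) t = d} =
    {\<omega> \<in> space M. \<exists>n. jump_time (\<lambda>s. Z s \<omega>) n \<le> ereal t \<and> ereal t < jump_time (\<lambda>s. Z s \<omega>) (Suc n) \<and>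
      card {k. k < n \<and> jump_chain (\<lambda>s. Z s \<omega>) (Suc k) = jump_chain (\<lambda>s. Z s \<omega>) k - 1} = d}" for d
  proof (intro Collect_cong conj_cong refl)
    fix \<omega> assume "\<omega> \<in> space M"
    note c = cadlag[OF this]
    obtain n where n: "jump_time (\<lambda>s. Z s \<omega>) n \<le> ereal t" "ereal t < jump_time (\<lambda>s. Z s \<omega>) (Suc n)"
      using jump_interval_exists[OF c t] by blast
    show "down_jumps (\<lambda>s. Z s \<omega>) t = d \<longleftrightarrow>
      (\<exists>n. jump_time (\<lambda>s. Z s \<omega>) n \<le> ereal t \<and> ereal t < jump_time (\<lambda>s. Z s \<omega>) (Suc n) \<and>
        card {k. k < n \<and> jump_chain (\<lambda>s. Z s \<omega>) (Suc k) = jump_chain (\<lambda>s. Z s \<omega>) k - 1} = d)"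
      using n by (auto simp: down_jumps_eq[OF c, of _ t, symmetric])
  qed
  also have "\<dots> d \<in> sets M" for d
    by measurable
  finally show ?thesis
    by (auto simp: measurable_count_space_eq2_countable vimage_def Int_def conj_commute)
qed

context countable_ctmc
begin

lemma AE_history_law_nonneg: "AE h in history_law M Z. \<forall>k. 0 \<le> snd (h !! k)"
  unfolding history_law_def
  by (subst AE_distr_iff[OF measurable_history])
     (auto simp: history_def to_stream_def intro!: real_of_ereal_pos less_imp_le[OF holding_time_pos] cadlag_paths)

lemma AE_history_law_start: "AE h in history_law M Z. fst (shd h) = x"
proof -
  have "prob {\<omega> \<in> space M. Z 0 \<omega> = x} = 1"
    using jump_chain_law[of 0 "\<lambda>_. x"] by simp
  then have "AE \<omega> in M. Z 0 \<omega> = x"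
    by (subst (asm) prob_eq_1) (auto intro!: measurable_sets_Collect[OF measurable_Z])
  then show ?thesis
    unfolding history_law_def
    by (subst AE_distr_iff[OF measurable_history]) (auto simp: history_def to_stream_def)
qed

end

section \<open>The backward equation\<close>

abbreviation up_rate :: "nat \<Rightarrow> int \<Rightarrow> real" where
  "up_rate q a \<equiv> real q powi (- a)"

abbreviation down_rate :: "nat \<Rightarrow> int \<Rightarrow> real" where
  "down_rate q a \<equiv> real q powi a"

definition total_rate :: "nat \<Rightarrow> int \<Rightarrow> real" where
  "total_rate q a = up_rate q a + down_rate q a"

definition step_pmf :: "nat \<Rightarrow> int \<Rightarrow> int pmf" where
  "step_pmf q a = map_pmf (\<lambda>up. if up then a + 1 else a - 1) (bernoulli_pmf (up_rate q a / total_rate q a))"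

locale q_chain =
  fixes q :: nat and M :: "int \<Rightarrow> 'w measure" and Z :: "int \<Rightarrow> real \<Rightarrow> 'w \<Rightarrow> int"
  assumes q_ge_2: "q \<ge> 2"
    and q_ctmc: "\<And>a. ctmc (M a) (Q_Z q) a (Z a)"
begin

lemma rates_pos: "up_rate q a > 0" "down_rate q a > 0" "total_rate q a > 0"
  using q_ge_2 by (auto simp: total_rate_def intro!: add_pos_pos zero_less_power_int)

lemma Q_Z_diag: "Q_Z q a a = - total_rate q a"
  by (simp add: Q_Z_def total_rate_def)

lemma up_prob: "0 \<le> up_rate q a / total_rate q a" "up_rate q a / total_rate q a \<le> 1"
    "1 - up_rate q a / total_rate q a = down_rate q a / total_rate q a"
  using rates_pos[of a] by (auto simp: total_rate_def field_simps)

lemma pmf_step_pmf: "pmf (step_pmf q a) b = jump_prob (Q_Z q) a b"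
proof -
  let ?f = "\<lambda>up. if up then a + 1 else a - 1"
  have [simp]: "?f -` {a + 1} = {True}" "?f -` {a - 1} = {False}"
    by (auto split: if_splits)
  have "?f -` {b} = {}" if "b \<noteq> a + 1" "b \<noteq> a - 1"
    using that by (auto split: if_splits)
  then show ?thesis
    using rates_pos[of a] up_prob[of a]
    by (cases "b = a + 1"; cases "b = a - 1")
       (auto simp: step_pmf_def pmf_map measure_pmf_single jump_prob_def Q_Z_diag, auto simp: Q_Z_def)
qed

sublocale ctmc_family M "Q_Z q" Z "step_pmf q"
proof (rule ctmc_family.intro)
  fix a
  interpret ctmc "M a" "Q_Z q" a "Z a" by (rule q_ctmc)
  show "countable_ctmc (M a) (Q_Z q) a (Z a)"
    by unfold_locales (use rates_pos in \<open>simp add: Q_Z_diag\<close>)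
qed (rule pmf_step_pmf)

definition end_prob :: "(nat \<times> int) set \<Rightarrow> int \<Rightarrow> real \<Rightarrow> real" where
  "end_prob A a t = measure (H a) {h. ends_in A t h}"

lemma sets_ends_in [measurable]: "{h. ends_in A t h} \<in> sets (H a)"
  using predE[OF measurable_ends_in_fixed_time, of A t] unfolding sets_H
  by (simp add: space_stream_space space_pair_measure)

lemma measurable_down_jumps_state:
  assumes "t \<ge> 0"
  shows "(\<lambda>\<omega>. (down_jumps (\<lambda>s. Z a s \<omega>) t, Z a t \<omega>)) \<in> M a \<rightarrow>\<^sub>M count_space UNIV"
proof -
  interpret countable_ctmc "M a" "Q_Z q" a "Z a" by (rule chain)
  have [measurable]: "(\<lambda>\<omega>. down_jumps (\<lambda>s. Z a s \<omega>) t) \<in> M a \<rightarrow>\<^sub>M count_space UNIV"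
    by (rule measurable_down_jumps[OF measurable_Z cadlag_paths assms])
  have [measurable]: "Z a t \<in> M a \<rightarrow>\<^sub>M count_space UNIV"
    by (rule measurable_Z[OF assms])
  show ?thesis
    unfolding measurable_count_space_eq2_countable by (auto simp: vimage_def)
qed

text \<open>
  Transfers the question from the given processes to the laws of their histories.
\<close>

lemma end_prob_eq:
  assumes "t \<ge> 0"
  shows "measure (distr (M a) (count_space UNIV) (\<lambda>\<omega>. (down_jumps (\<lambda>s. Z a s \<omega>) t, Z a t \<omega>))) A
    = end_prob A a t"
proof -
  interpret countable_ctmc "M a" "Q_Z q" a "Z a" by (rule chain)
  note DZ = measurable_down_jumps_state[OF assms, of a]
  have "measure (distr (M a) (count_space UNIV) (\<lambda>\<omega>. (down_jumps (\<lambda>s. Z a s \<omega>) t, Z a t \<omega>))) A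
    = prob {\<omega> \<in> space (M a). (down_jumps (\<lambda>s. Z a s \<omega>) t, Z a t \<omega>) \<in> A}"
    by (subst measure_distr[OF DZ]) (auto simp: vimage_def Int_def conj_commute)
  also have "\<dots> = prob {\<omega> \<in> space (M a). ends_in A t (history (\<lambda>s. Z a s \<omega>))}"
  proof (rule measure_eq_AE)
    show "AE \<omega> in M a. \<omega> \<in> {\<omega> \<in> space (M a). (down_jumps (\<lambda>s. Z a s \<omega>) t, Z a t \<omega>) \<in> A}
      \<longleftrightarrow> \<omega> \<in> {\<omega> \<in> space (M a). ends_in A t (history (\<lambda>s. Z a s \<omega>))}"
      using AE_holding_time_finite AE_space
      by eventually_elim (simp add: down_jumps_history[OF cadlag_paths assms])
    show "{\<omega> \<in> space (M a). (down_jumps (\<lambda>s. Z a s \<omega>) t, Z a t \<omega>) \<in> A} \<in> sets (M a)"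
      using measurable_sets[OF DZ, of A] by (simp add: vimage_def Int_def conj_commute)
    show "{\<omega> \<in> space (M a). ends_in A t (history (\<lambda>s. Z a s \<omega>))} \<in> sets (M a)"
      by (rule predE[OF measurable_compose[OF measurable_history measurable_ends_in_fixed_time]])
  qed
  also have "\<dots> = end_prob A a t"
    unfolding end_prob_def history_law_def
    using predE[OF measurable_ends_in_fixed_time, of A t]
    by (subst measure_distr[OF measurable_history])
       (auto simp: vimage_def Int_def conj_commute space_stream_space space_pair_measure)
  finally show ?thesis .
qed

lemma end_prob_nonneg: "0 \<le> end_prob A a t"
  by (simp add: end_prob_def)

lemma end_prob_le_1: "end_prob A a t \<le> 1"
  unfolding end_prob_def by (rule prob_space.prob_le_1[OF prob_space_H])

lemma measurable_end_prob [measurable]: "end_prob A a \<in> borel_measurable borel"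
proof -
  interpret H: prob_space "H a" by (rule prob_space_H)
  have "{p \<in> space (borel \<Otimes>\<^sub>M H a). case p of (t, h) \<Rightarrow> ends_in A t h} \<in> sets (borel \<Otimes>\<^sub>M H a)"
    using predE[OF measurable_ends_in, of A]
    by (simp add: space_pair_measure space_H space_stream_space cong: sets_pair_measure_cong[OF refl sets_H])
  from H.measurable_emeasure_Pair[OF this]
  have "(\<lambda>t. emeasure (H a) {h. ends_in A t h}) \<in> borel_measurable borel"
    by (simp add: space_pair_measure space_H vimage_def)
  then show ?thesis
    unfolding end_prob_def[abs_def] measure_def by measurable
qed

text \<open>
  Arrival times are nonnegative almost surely. Extending by \<open>0\<close> to negative times in this way lets the first-step
  equation be integrated over all waiting times.
\<close>

lemma end_prob_neg_time: "t < 0 \<Longrightarrow> end_prob A a t = 0"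
  unfolding end_prob_def
  by (rule measure_eq_0_null_sets, rule AE_iff_null_sets[THEN iffD2])
     (use countable_ctmc.AE_history_law_nonneg[OF chain, of a] in
       \<open>auto elim!: eventually_mono simp: not_ends_in_neg\<close>)

text \<open>
  The two summands exclude each other: before the first jump the remaining time is negative and the
  second one vanishes, afterwards the first one does.
\<close>

lemma end_prob_first_step:
  assumes "t \<ge> 0"
  shows "emeasure (H b) {h. ends_in A t ((a, s) ## h)}
    = ennreal (of_bool ((0, a) \<in> A)) * indicator {t<..} s
      + ennreal (end_prob (if b = a - 1 then after_down A else A) b (t - s))"
proof -
  interpret H: prob_space "H b" by (rule prob_space_H)
  let ?A = "if b = a - 1 then after_down A else A"
  have [measurable]: "{h. ends_in A t ((a, s) ## h)} \<in> sets (H b)"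
  proof -
    have "(\<lambda>h. (a, s) ## h) \<in> stream_space state_time \<rightarrow>\<^sub>M stream_space state_time"
      by measurable
    from predE[OF measurable_compose[OF this measurable_ends_in_fixed_time], of A t]
    show ?thesis unfolding sets_H by (simp add: space_stream_space space_pair_measure)
  qed
  note start = countable_ctmc.AE_history_law_start[OF chain, of b]
  note nonneg = countable_ctmc.AE_history_law_nonneg[OF chain, of b]
  show ?thesis
  proof (cases "t < s")
    case True
    have "emeasure (H b) {h. ends_in A t ((a, s) ## h)} = emeasure (H b) (if (0, a) \<in> A then UNIV else {})"
    proof (rule emeasure_eq_AE)
      show "AE h in H b. h \<in> {h. ends_in A t ((a, s) ## h)} \<longleftrightarrow> h \<in> (if (0, a) \<in> A then UNIV else {})"
        using nonneg
      proof eventually_elim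
        case (elim h)
        then have "\<not> ends_in B (t - s) h" for B
          using True by (intro not_ends_in_neg) auto
        then show ?case using True assms by (auto simp: ends_in_Stream)
      qed
    qed (use sets.top[of "H b"] in \<open>auto simp: space_H\<close>)
    also have "\<dots> = ennreal (of_bool ((0, a) \<in> A))"
      using H.emeasure_space_1 by (simp add: space_H)
    finally show ?thesis
      using True by (simp add: end_prob_neg_time)
  next
    case False
    have "emeasure (H b) {h. ends_in A t ((a, s) ## h)} = emeasure (H b) {h. ends_in ?A (t - s) h}"
    proof (rule emeasure_eq_AE)
      show "AE h in H b. h \<in> {h. ends_in A t ((a, s) ## h)} \<longleftrightarrow> h \<in> {h. ends_in ?A (t - s) h}"
        using start by eventually_elim (use False in \<open>simp add: ends_in_Stream\<close>)
    qed auto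
    also have "\<dots> = ennreal (end_prob ?A b (t - s))"
      by (simp add: end_prob_def H.emeasure_eq_measure)
    finally show ?thesis using False by simp
  qed
qed

text \<open>
  The substitution of the remaining time \<open>r = t - s\<close> for the waiting time \<open>s\<close>.
\<close>

lemma nn_integral_exponential_end_prob:
  "(\<integral>\<^sup>+s. ennreal (end_prob A b (t - s)) \<partial>E a)
    = (\<integral>\<^sup>+r. ennreal (total_rate q a * exp (- total_rate q a * (t - r)) * end_prob A b r) * indicator {0..t} r \<partial>lborel)"
proof -
  let ?l = "total_rate q a"
  have [measurable]: "end_prob A b \<in> borel_measurable lborel" by simp
  have "(\<integral>\<^sup>+s. ennreal (end_prob A b (t - s)) \<partial>E a)
    = (\<integral>\<^sup>+s. ennreal (exponential_density ?l s) * ennreal (end_prob A b (t - s)) \<partial>lborel)"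
    unfolding Q_Z_diag by (subst nn_integral_density) auto
  also have "\<dots> = (\<integral>\<^sup>+r. ennreal (exponential_density ?l (t - r)) * ennreal (end_prob A b r) \<partial>lborel)"
    by (subst nn_integral_real_affine[where c = "-1" and t = t]) auto
  also have "\<dots> = (\<integral>\<^sup>+r. ennreal (?l * exp (- ?l * (t - r)) * end_prob A b r) * indicator {0..t} r \<partial>lborel)"
    using rates_pos(3)[of a]
    by (intro nn_integral_cong)
       (auto simp: exponential_density_def end_prob_neg_time ennreal_mult'[symmetric] end_prob_nonneg algebra_simps split: split_indicator)
  finally show ?thesis .
qed

lemma nn_integral_step_pmf:
  "(\<integral>\<^sup>+b. f b \<partial>measure_pmf (step_pmf q a))
    = ennreal (up_rate q a / total_rate q a) * f (a + 1) + ennreal (down_rate q a / total_rate q a) * f (a - 1)"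
  unfolding step_pmf_def
  by (simp add: up_prob mult.commute)

text \<open>
  The backward equation in integrated form, multiplied by the integrating factor
  \<open>exp (total_rate q a * t)\<close>. In this form it holds for functions that are merely measurable
  in time; their continuity and differentiability are consequences of it.
\<close>

lemma end_prob_renewal:
  assumes "t \<ge> 0"
  shows "((\<lambda>r. exp (total_rate q a * r) * (up_rate q a * end_prob A (a + 1) r + down_rate q a * end_prob (after_down A) (a - 1) r))
    has_integral (exp (total_rate q a * t) * end_prob A a t - of_bool ((0, a) \<in> A))) {0..t}"
proof -
  let ?l = "total_rate q a" and ?c = "of_bool ((0, a) \<in> A) :: real"
  note pos = rates_pos[of a]
  define g where "g r = up_rate q a * end_prob A (a + 1) r + down_rate q a * end_prob (after_down A) (a - 1) r" for r
  have g_nonneg: "0 \<le> g r" for r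
    using pos by (simp add: g_def end_prob_nonneg)
  have g[measurable]: "g \<in> borel_measurable borel"
    unfolding g_def by measurable
  define I where "I b = (\<integral>\<^sup>+r. ennreal (?l * exp (- ?l * (t - r)) * end_prob (if b = a - 1 then after_down A else A) b r) * indicator {0..t} r \<partial>lborel)" for b
  have inner: "(\<integral>\<^sup>+s. emeasure (H b) {h. ends_in A t ((a, s) ## h)} \<partial>E a) = ennreal (?c * exp (- ?l * t)) + I b" for b
  proof -
    have [measurable]: "end_prob B b' \<in> borel_measurable lborel" for B b' by simp
    have "(\<integral>\<^sup>+s. emeasure (H b) {h. ends_in A t ((a, s) ## h)} \<partial>E a)
      = (\<integral>\<^sup>+s. ennreal ?c * indicator {t<..} s \<partial>E a) + (\<integral>\<^sup>+s. ennreal (end_prob (if b = a - 1 then after_down A else A) b (t - s)) \<partial>E a)"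
      unfolding end_prob_first_step[OF assms] by (rule nn_integral_add) auto
    also have "(\<integral>\<^sup>+s. ennreal ?c * indicator {t<..} s \<partial>E a) = ennreal (?c * exp (- ?l * t))"
      using emeasure_exponential_gt[OF pos(3), of t] assms
      by (subst nn_integral_cmult_indicator) (auto simp: Q_Z_diag ennreal_mult')
    finally show ?thesis unfolding nn_integral_exponential_end_prob I_def .
  qed
  have p1: "up_rate q a / ?l + down_rate q a / ?l = 1"
    using up_prob(3)[of a] by linarith
  have "ennreal (end_prob A a t) = emeasure (H a) {h. ends_in A t h}"
    by (simp add: end_prob_def prob_space_H finite_measure.emeasure_eq_measure prob_space.finite_measure)
  also have "\<dots> = (\<integral>\<^sup>+b. \<integral>\<^sup>+s. emeasure (H b) {h. (a, s) ## h \<in> {h. ends_in A t h}} \<partial>E a \<partial>measure_pmf (step_pmf q a))"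
    by (rule emeasure_H_first_step) (use sets_ends_in sets_H in blast)
  also have "\<dots> = ennreal (up_rate q a / ?l) * (ennreal (?c * exp (- ?l * t)) + I (a + 1))
      + ennreal (down_rate q a / ?l) * (ennreal (?c * exp (- ?l * t)) + I (a - 1))"
    by (simp add: inner nn_integral_step_pmf)
  also have "\<dots> = (ennreal (up_rate q a / ?l) + ennreal (down_rate q a / ?l)) * ennreal (?c * exp (- ?l * t))
      + (ennreal (up_rate q a / ?l) * I (a + 1) + ennreal (down_rate q a / ?l) * I (a - 1))"
    by (simp add: algebra_simps)
  also have "ennreal (up_rate q a / ?l) + ennreal (down_rate q a / ?l) = 1"
    using pos p1 by (subst ennreal_plus[symmetric]) auto
  also have "ennreal (up_rate q a / ?l) * I (a + 1) + ennreal (down_rate q a / ?l) * I (a - 1)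
    = (\<integral>\<^sup>+r. ennreal (exp (- ?l * (t - r)) * g r * indicator {0..t} r) \<partial>lborel)"
  proof -
    have [measurable]: "end_prob B b' \<in> borel_measurable lborel" for B b' by simp
    have "ennreal (up_rate q a / ?l) * I (a + 1) + ennreal (down_rate q a / ?l) * I (a - 1)
      = (\<integral>\<^sup>+r. ennreal (up_rate q a / ?l) * (ennreal (?l * exp (- ?l * (t - r)) * end_prob A (a + 1) r) * indicator {0..t} r)
          + ennreal (down_rate q a / ?l) * (ennreal (?l * exp (- ?l * (t - r)) * end_prob (after_down A) (a - 1) r) * indicator {0..t} r) \<partial>lborel)"
      unfolding I_def by (subst nn_integral_add) (auto simp: nn_integral_cmult)
    also have "\<dots> = (\<integral>\<^sup>+r. ennreal (exp (- ?l * (t - r)) * g r * indicator {0..t} r) \<partial>lborel)"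
    proof (rule nn_integral_cong)
      fix r
      have scale: "ennreal (c / ?l) * ennreal (?l * e * v) = ennreal (c * e * v)"
        if "0 \<le> c" for c e v :: real
        using that pos(3) by (subst ennreal_mult'[symmetric]) (auto simp: mult.assoc)
      have add: "ennreal (up_rate q a * e * v) + ennreal (down_rate q a * e * w)
          = ennreal (e * (up_rate q a * v + down_rate q a * w))"
        if "0 \<le> e" "0 \<le> v" "0 \<le> w" for e v w :: real
        using that pos by (subst ennreal_plus[symmetric]) (auto simp: distrib_left mult_ac)
      show "ennreal (up_rate q a / ?l) * (ennreal (?l * exp (- ?l * (t - r)) * end_prob A (a + 1) r) * indicator {0..t} r)
          + ennreal (down_rate q a / ?l) * (ennreal (?l * exp (- ?l * (t - r)) * end_prob (after_down A) (a - 1) r) * indicator {0..t} r)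
        = ennreal (exp (- ?l * (t - r)) * g r * indicator {0..t} r)"
      proof (cases "r \<in> {0..t}")
        case True
        then show ?thesis
          using pos by (simp only: indicator_simps mult_1_right scale less_imp_le add exp_ge_zero end_prob_nonneg g_def)
      qed simp
    qed
    finally show ?thesis .
  qed
  finally have eq: "ennreal (end_prob A a t) = ennreal (?c * exp (- ?l * t))
      + (\<integral>\<^sup>+r. ennreal (exp (- ?l * (t - r)) * g r * indicator {0..t} r) \<partial>lborel)" by simp
  have le: "ennreal (?c * exp (- ?l * t)) \<le> ennreal (end_prob A a t)"
    unfolding eq by simp
  have "(\<integral>\<^sup>+r. ennreal (exp (- ?l * (t - r)) * g r * indicator {0..t} r) \<partial>lborel)
      = ennreal (end_prob A a t) - ennreal (?c * exp (- ?l * t))"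
    unfolding eq by simp
  also have "\<dots> = ennreal (end_prob A a t - ?c * exp (- ?l * t))"
    by (rule ennreal_minus) simp
  finally have "((\<lambda>r. exp (- ?l * (t - r)) * g r * indicator {0..t} r) has_integral (end_prob A a t - ?c * exp (- ?l * t))) UNIV"
    using le by (intro nn_integral_has_integral) (auto simp: g_nonneg end_prob_nonneg ennreal_le_iff2)
  then have "((\<lambda>r. exp (- ?l * (t - r)) * g r) has_integral (end_prob A a t - ?c * exp (- ?l * t))) {0..t}"
    by (subst has_integral_restrict_UNIV[symmetric])
       (erule has_integral_eq[rotated], simp split: split_indicator)
  from has_integral_mult_right[OF this, of "exp (?l * t)"]
  have "((\<lambda>r. exp (?l * t) * (exp (- ?l * (t - r)) * g r)) has_integral
      exp (?l * t) * (end_prob A a t - ?c * exp (- ?l * t))) {0..t}" .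
  moreover have "exp (?l * t) * (exp (- ?l * (t - r)) * g r) = exp (?l * r) * g r" for r
  proof -
    have "exp (?l * t) * exp (- ?l * (t - r)) = exp (?l * r)"
      unfolding exp_add[symmetric] by (simp add: algebra_simps)
    then show ?thesis by (simp only: mult.assoc[symmetric])
  qed
  moreover have "exp (?l * t) * (end_prob A a t - ?c * exp (- ?l * t)) = exp (?l * t) * end_prob A a t - ?c"
    by (simp add: right_diff_distrib exp_minus)
  ultimately show ?thesis
    unfolding g_def by (simp only:)
qed

end

section \<open>A bound on the time derivative that grows only linearly in the depth\<close>

text \<open>
  A quantity that starts at \<open>0\<close>, decays at rate \<open>l\<close> and is driven by a force of size at most \<open>B\<close>
  stays below the equilibrium value \<open>B / l\<close>: multiplied by the integrating factor
  \<open>exp (l * r)\<close>, the difference \<open>w r - B / l\<close> is nonincreasing.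
\<close>

lemma relaxation_bound:
  fixes w h :: "real \<Rightarrow> real"
  assumes "l > 0" "t \<ge> 0" "B \<ge> 0" "w 0 = 0" and cont: "continuous_on {0..t} w"
    and deriv: "\<And>r. 0 < r \<Longrightarrow> r < t \<Longrightarrow> (w has_real_derivative - l * w r + h r) (at r)"
    and h: "\<And>r. 0 < r \<Longrightarrow> r < t \<Longrightarrow> \<bar>h r\<bar> \<le> B"
  shows "\<bar>w t\<bar> \<le> B / l"
proof -
  have upper: "w' t \<le> B / l"
    if "w' 0 = 0" and cont: "continuous_on {0..t} w'"
      and deriv: "\<And>r. 0 < r \<Longrightarrow> r < t \<Longrightarrow> (w' has_real_derivative - l * w' r + h' r) (at r)"
      and h: "\<And>r. 0 < r \<Longrightarrow> r < t \<Longrightarrow> h' r \<le> B" for w' h' :: "real \<Rightarrow> real"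
  proof -
    \<comment> \<open>the derivative of this function is \<open>exp (l * r) * (h' r - B)\<close>\<close>
    let ?F = "\<lambda>r. exp (l * r) * (w' r - B / l)"
    have "?F t \<le> ?F 0"
    proof (rule DERIV_nonpos_imp_decreasing_open[OF \<open>t \<ge> 0\<close>])
      show "continuous_on {0..t} ?F" by (intro continuous_intros cont)
      fix r assume r: "0 < r" "r < t"
      have "(?F has_real_derivative exp (l * r) * (h' r - B)) (at r)"
        using \<open>l > 0\<close>
        by (auto intro!: derivative_eq_intros deriv[OF r] simp: field_simps)
      moreover have "exp (l * r) * (h' r - B) \<le> 0"
        using h[OF r] by (simp add: mult_le_0_iff)
      ultimately show "\<exists>y. (?F has_real_derivative y) (at r) \<and> y \<le> 0" by blast
    qed
    also have "?F 0 \<le> 0" using \<open>w' 0 = 0\<close> \<open>B \<ge> 0\<close> \<open>l > 0\<close> by simp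
    finally show ?thesis by (simp add: mult_le_0_iff)
  qed
  have "w t \<le> B / l"
    by (rule upper[OF \<open>w 0 = 0\<close> cont deriv]) (use h in \<open>auto simp: abs_le_iff\<close>)
  moreover have "- w t \<le> B / l"
  proof (rule upper[of "\<lambda>r. - w r" "\<lambda>r. - h r"])
    fix r assume r: "0 < r" "r < t"
    show "((\<lambda>r. - w r) has_real_derivative - l * - w r + - h r) (at r)"
      using DERIV_minus[OF deriv[OF r]] by simp
    show "- h r \<le> B" using h[OF r] by (simp add: abs_le_iff)
  qed (use \<open>w 0 = 0\<close> cont in \<open>auto intro: continuous_intros\<close>)
  ultimately show ?thesis by (simp add: abs_le_iff)
qed

context q_chain
begin

definition influx :: "(nat \<times> int) set \<Rightarrow> int \<Rightarrow> real \<Rightarrow> real" where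
  "influx A a t = up_rate q a * end_prob A (a + 1) t + down_rate q a * end_prob (after_down A) (a - 1) t"

text \<open>
  The time derivative of \<open>end_prob\<close>, see \<open>end_prob_has_derivative\<close>.
\<close>

definition velocity :: "(nat \<times> int) set \<Rightarrow> int \<Rightarrow> real \<Rightarrow> real" where
  "velocity A a t = up_rate q a * (end_prob A (a + 1) t - end_prob A a t) + down_rate q a * (end_prob (after_down A) (a - 1) t - end_prob A a t)"

lemma end_prob_eq_integral:
  assumes "t \<ge> 0"
  shows "end_prob A a t = exp (- total_rate q a * t)
    * (of_bool ((0, a) \<in> A) + integral {0..t} (\<lambda>r. exp (total_rate q a * r) * influx A a r))"
proof -
  have "exp (total_rate q a * t) * end_prob A a t
    = of_bool ((0, a) \<in> A) + integral {0..t} (\<lambda>r. exp (total_rate q a * r) * influx A a r)"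
    using integral_unique[OF end_prob_renewal[OF assms, of a A]] by (simp add: influx_def)
  moreover have "exp (- total_rate q a * t) * (exp (total_rate q a * t) * end_prob A a t) = end_prob A a t"
    by (simp add: exp_minus)
  ultimately show ?thesis by metis
qed

text \<open>
  An indefinite integral is continuous. As this holds for all starting points and targets, the
  integrand of \<open>end_prob_eq_integral\<close> is continuous as well, and the integral is differentiable.
\<close>

lemma continuous_on_end_prob: "continuous_on {0..T} (end_prob A a)"
proof (cases "T \<ge> 0")
  case True
  have "(\<lambda>r. exp (total_rate q a * r) * influx A a r) integrable_on {0..T}"
    using end_prob_renewal[OF True, of a A] by (auto simp: integrable_on_def influx_def)
  then have "continuous_on {0..T} (\<lambda>t. exp (- total_rate q a * t)
    * (of_bool ((0, a) \<in> A) + integral {0..t} (\<lambda>r. exp (total_rate q a * r) * influx A a r)))"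
    by (intro continuous_intros indefinite_integral_continuous_1)
  then show ?thesis
    by (rule continuous_on_eq) (auto simp: end_prob_eq_integral)
qed simp

lemma continuous_on_velocity: "continuous_on {0..T} (velocity A a)"
  unfolding velocity_def by (intro continuous_intros continuous_on_end_prob)

lemma end_prob_has_derivative:
  assumes "t > 0"
  shows "(end_prob A a has_real_derivative velocity A a t) (at t)"
proof -
  define l where "l = total_rate q a"
  define J where "J t = integral {0..t} (\<lambda>r. exp (l * r) * influx A a r)" for t
  have end_prob: "end_prob A a s = exp (- l * s) * (of_bool ((0, a) \<in> A) + J s)" if "s \<ge> 0" for s
    using end_prob_eq_integral[OF that] unfolding l_def J_def .
  have "continuous_on {0..t + 1} (\<lambda>r. exp (l * r) * influx A a r)"
    unfolding influx_def by (intro continuous_intros continuous_on_end_prob)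
  from integral_has_real_derivative[OF this, of t] assms
  have "(J has_real_derivative exp (l * t) * influx A a t) (at t within {0..t + 1})"
    unfolding J_def by simp
  moreover have "at t within {0..t + 1} = at t"
    using assms by (intro at_within_interior) simp
  ultimately have J: "(J has_real_derivative exp (l * t) * influx A a t) (at t)" by (simp only:)
  have "((\<lambda>t. exp (- l * t)) has_real_derivative - l * exp (- l * t)) (at t)"
    by (auto intro!: derivative_eq_intros)
  from DERIV_mult[OF this DERIV_add[OF DERIV_const J]]
  have "((\<lambda>t. exp (- l * t) * (of_bool ((0, a) \<in> A) + J t)) has_real_derivative
      - l * exp (- l * t) * (of_bool ((0, a) \<in> A) + J t) + (0 + exp (l * t) * influx A a t) * exp (- l * t)) (at t)" .
  also have "- l * exp (- l * t) * (of_bool ((0, a) \<in> A) + J t) + (0 + exp (l * t) * influx A a t) * exp (- l * t)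
    = - l * end_prob A a t + influx A a t"
  proof -
    have "(0 + exp (l * t) * influx A a t) * exp (- l * t) = influx A a t"
      by (simp add: exp_minus)
    then show ?thesis
      using end_prob[of t] assms by simp
  qed
  also have "\<dots> = velocity A a t"
    by (simp add: l_def velocity_def influx_def total_rate_def algebra_simps)
  finally show ?thesis
    by (rule has_field_derivative_transform_within_open[OF _ open_greaterThan[of 0]])
       (use assms in \<open>simp_all add: end_prob\<close>)
qed

lemma velocity_bound: "\<bar>velocity A a t\<bar> \<le> total_rate q a"
proof -
  have d: "\<bar>end_prob B b t - end_prob A a t\<bar> \<le> 1" for B b
    using end_prob_nonneg[of B b t] end_prob_nonneg[of A a t] end_prob_le_1[of B b t] end_prob_le_1[of A a t] by linarith
  have "\<bar>velocity A a t\<bar> \<le> \<bar>up_rate q a * (end_prob A (a + 1) t - end_prob A a t)\<bar> + \<bar>down_rate q a * (end_prob (after_down A) (a - 1) t - end_prob A a t)\<bar>"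
    unfolding velocity_def by (rule abs_triangle_ineq)
  also have "\<dots> \<le> up_rate q a * 1 + down_rate q a * 1"
    unfolding abs_mult using rates_pos[of a] d by (intro add_mono mult_mono) auto
  finally show ?thesis by (simp add: total_rate_def)
qed

text \<open>
  The backward equation is linear with coefficients that do not depend on time, so its time
  derivative satisfies the same equation.
\<close>

lemma velocity_has_derivative:
  assumes "t > 0"
  shows "(velocity A a has_real_derivative
    up_rate q a * velocity A (a + 1) t + down_rate q a * velocity (after_down A) (a - 1) t - total_rate q a * velocity A a t) (at t)"
proof -
  have eq: "velocity A a = (\<lambda>t. up_rate q a * (end_prob A (a + 1) t - end_prob A a t)
      + down_rate q a * (end_prob (after_down A) (a - 1) t - end_prob A a t))"
    by (rule ext) (simp add: velocity_def)
  show ?thesis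
    by (subst eq) (rule derivative_eq_intros end_prob_has_derivative assms refl
      | simp add: total_rate_def algebra_simps)+
qed

text \<open>
  Downward induction on the starting point. The function \<open>w r = r * velocity A a r\<close> decays at rate
  \<open>total_rate q a\<close>, driven by three terms. The factor \<open>r\<close> contributes \<open>velocity A a r\<close>, which is at most the
  rate itself and costs the constant \<open>1\<close> after division by the rate. The term from \<open>a + 1\<close> has a weight
  below the rate and is covered by the induction hypothesis. For the term from \<open>a - 1\<close> the trivial bound
  suffices, because the small downward rate at \<open>a\<close> compensates the total rate at \<open>a - 1\<close> up to the
  constant \<open>2 * q\<close>.
\<close>

lemma scaled_velocity_bound:
  assumes "0 \<le> t" "t \<le> T"
  shows "\<bar>t * velocity A (- int n) t\<bar> \<le> 2 * T + real n * (1 + 2 * real q * T)"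
  using assms
proof (induction n arbitrary: A t)
  case 0
  have "total_rate q 0 = 2" by (simp add: total_rate_def)
  then have "\<bar>t\<bar> * \<bar>velocity A 0 t\<bar> \<le> T * 2"
    using 0 velocity_bound[of A 0 t] by (intro mult_mono) auto
  then show ?case by (simp add: abs_mult)
next
  case (Suc n)
  let ?a = "- int (Suc n)"
  let ?l = "total_rate q ?a" and ?K = "2 * T + real n * (1 + 2 * real q * T)"
  let ?up = "up_rate q ?a" and ?down = "down_rate q ?a"
  let ?h = "\<lambda>r. velocity A ?a r + ?up * (r * velocity A (?a + 1) r) + ?down * (r * velocity (after_down A) (?a - 1) r)"
  note pos = rates_pos[of ?a]
  have q: "real q \<ge> 2" using q_ge_2 by simp
  have T: "T \<ge> 0" using Suc.prems by simp
  have K: "?K \<ge> 0" using T q by simp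
  have up: "?up = real q ^ Suc n"
    by (simp only: minus_minus power_int_of_nat)
  have l: "?l \<ge> 1" "?up \<le> ?l"
    using pos(2) one_le_power[of "real q" "Suc n"] q up unfolding total_rate_def by linarith+
  have down: "?down * total_rate q (?a - 1) \<le> 2 * real q"
  proof -
    have "?down * total_rate q (?a - 1) = real q powi (?a + (1 - ?a)) + real q powi (?a + (?a - 1))"
      using q by (simp add: total_rate_def distrib_left power_int_add[symmetric])
    also have "\<dots> = real q + real q powi (- int (2 * n + 3))"
    proof -
      have "?a + (1 - ?a) = 1" "?a + (?a - 1) = - int (2 * n + 3)" by simp_all
      then show ?thesis by (simp only: power_int_1_right)
    qed
    also have "real q powi (- int (2 * n + 3)) \<le> 1"
      using q by (simp only: power_int_minus power_int_of_nat) (simp add: inverse_le_1_iff)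
    finally show ?thesis using q by simp
  qed
  have "\<bar>t * velocity A ?a t\<bar> \<le> (?l + ?up * ?K + 2 * real q * T) / ?l"
  proof (rule relaxation_bound[where w = "\<lambda>r. r * velocity A ?a r" and h = ?h])
    show "continuous_on {0..t} (\<lambda>r. r * velocity A ?a r)"
      by (intro continuous_intros continuous_on_velocity)
    fix r assume r: "0 < r" "r < t"
    then have rT: "0 \<le> r" "r \<le> T" using Suc.prems by auto
    show "((\<lambda>r. r * velocity A ?a r) has_real_derivative - ?l * (r * velocity A ?a r) + ?h r) (at r)"
      by (rule derivative_eq_intros velocity_has_derivative r refl)+ (simp add: algebra_simps)
    have "?a + 1 = - int n" by simp
    then have 1: "\<bar>?up * (r * velocity A (?a + 1) r)\<bar> \<le> ?up * ?K"
      using Suc.IH[OF rT, of A] pos unfolding abs_mult[of ?up] by (intro mult_mono) auto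
    have "\<bar>?down * (r * velocity (after_down A) (?a - 1) r)\<bar> = r * (?down * \<bar>velocity (after_down A) (?a - 1) r\<bar>)"
      using pos rT by (simp add: abs_mult)
    also have "\<dots> \<le> T * (?down * total_rate q (?a - 1))"
      using pos rT by (intro mult_mono velocity_bound) auto
    also have "\<dots> \<le> T * (2 * real q)"
      using down T by (intro mult_left_mono) auto
    finally have 2: "\<bar>?down * (r * velocity (after_down A) (?a - 1) r)\<bar> \<le> 2 * real q * T"
      by (simp add: mult_ac)
    show "\<bar>?h r\<bar> \<le> ?l + ?up * ?K + 2 * real q * T"
      using velocity_bound[of A ?a r] 1 2 by linarith
  qed (use pos Suc.prems T K q in auto)
  also have "\<dots> = 1 + (?up / ?l) * ?K + 2 * real q * T / ?l"
    using pos by (simp add: field_simps)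
  also have "\<dots> \<le> 1 + 1 * ?K + 2 * real q * T"
  proof -
    have "(?up / ?l) * ?K \<le> 1 * ?K"
      using l pos K by (intro mult_right_mono) auto
    moreover have "2 * real q * T / ?l \<le> 2 * real q * T / 1"
      using l(1) T q by (intro divide_left_mono) auto
    ultimately show ?thesis by linarith
  qed
  also have "\<dots> = 2 * T + real (Suc n) * (1 + 2 * real q * T)"
    by (simp add: algebra_simps)
  finally show ?case .
qed

text \<open>
  The backward equation solved for the difference of neighbouring starting points, divided by
  \<open>q ^ n\<close>, the upward rate in \<open>- int n\<close>.
\<close>

lemma end_prob_neighbour_bound:
  assumes "t > 0"
  shows "\<bar>end_prob A (1 - int n) t - end_prob A (- int n) t\<bar> \<le> (3 + 1 / t + 2 * real q) * (real n + 1) * (1 / 2) ^ n"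
proof -
  let ?a = "- int n"
  let ?d = "end_prob (after_down A) (?a - 1) t - end_prob A ?a t"
  let ?down = "down_rate q ?a"
  note pos = rates_pos[of ?a]
  have q: "real q \<ge> 2" using q_ge_2 by simp
  have down: "?down = (1 / real q) ^ n" by (simp add: power_int_minus power_one_over inverse_eq_divide)
  have down_le: "?down \<le> (1 / 2) ^ n" "?down \<le> 1"
    unfolding down using q by (auto intro!: power_mono power_le_one simp: divide_simps)
  have ud: "?down * up_rate q ?a = 1"
    using q by (simp add: power_int_minus)
  have "end_prob A (1 - int n) t - end_prob A ?a t = ?down * (velocity A ?a t - ?down * ?d)"
  proof -
    have "?down * (velocity A ?a t - ?down * ?d) = (?down * up_rate q ?a) * (end_prob A (?a + 1) t - end_prob A ?a t)"
      unfolding velocity_def by (simp only: add_diff_cancel_right' mult.assoc)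
    then show ?thesis unfolding ud by simp
  qed
  then have "\<bar>end_prob A (1 - int n) t - end_prob A ?a t\<bar> = ?down * \<bar>velocity A ?a t - ?down * ?d\<bar>"
    using pos by (simp add: abs_mult)
  also have "\<dots> \<le> ?down * (\<bar>velocity A ?a t\<bar> + 1)"
  proof (rule mult_left_mono)
    have "\<bar>?d\<bar> \<le> 1"
      using end_prob_nonneg[of "after_down A" "?a - 1" t] end_prob_nonneg[of A ?a t]
        end_prob_le_1[of "after_down A" "?a - 1" t] end_prob_le_1[of A ?a t] by linarith
    then have "\<bar>?down * ?d\<bar> \<le> 1 * 1"
      unfolding abs_mult using pos down_le by (intro mult_mono) auto
    then show "\<bar>velocity A ?a t - ?down * ?d\<bar> \<le> \<bar>velocity A ?a t\<bar> + 1" by linarith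
  qed (use pos in auto)
  also have "\<dots> \<le> (1 / 2) ^ n * ((3 + 1 / t + 2 * real q) * (real n + 1))"
  proof (rule mult_mono[OF down_le(1)])
    have "t * \<bar>velocity A ?a t\<bar> \<le> 2 * t + real n * (1 + 2 * real q * t)"
      using scaled_velocity_bound[of t t A n] assms by (simp add: abs_mult)
    then have "\<bar>velocity A ?a t\<bar> \<le> 2 + real n * (1 / t + 2 * real q)"
      using assms by (simp add: field_simps)
    moreover have "(3 + 1 / t + 2 * real q) * (real n + 1) = 2 + real n * (1 / t + 2 * real q) + 1 + (1 / t + 2 * real q + 3 * real n)"
      by (simp add: algebra_simps)
    moreover have "1 / t \<ge> 0" using assms by simp
    ultimately show "\<bar>velocity A ?a t\<bar> + 1 \<le> (3 + 1 / t + 2 * real q) * (real n + 1)"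
      using q by linarith
  qed auto
  finally show ?thesis by (simp add: mult_ac)
qed

text \<open>
  Telescoping. The function \<open>e n = C * (n + 3) * (1 / 2) ^ n\<close> is chosen such that \<open>e m - e (m + 1)\<close> is
  exactly the bound on the difference between depth \<open>m\<close> and depth \<open>m + 1\<close>.
\<close>

lemma end_prob_Cauchy:
  assumes "t > 0" "n \<le> m"
  shows "\<bar>end_prob A (- int m) t - end_prob A (- int n) t\<bar> \<le> (3 + 1 / t + 2 * real q) * (real n + 3) * (1 / 2) ^ n
    - (3 + 1 / t + 2 * real q) * (real m + 3) * (1 / 2) ^ m"
  using assms(2)
proof (induction m rule: dec_induct)
  case (step m)
  let ?C = "3 + 1 / t + 2 * real q"
  have "\<bar>end_prob A (- int (Suc m)) t - end_prob A (- int m) t\<bar> \<le> ?C * (real m + 2) * (1 / 2) ^ Suc m"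
    using end_prob_neighbour_bound[OF assms(1), of A "Suc m"] by (simp add: abs_minus_commute add.commute)
  also have "\<dots> = ?C * (real m + 3) * (1 / 2) ^ m - ?C * (real (Suc m) + 3) * (1 / 2) ^ Suc m"
    by (simp add: algebra_simps)
  finally show ?case using step.IH by linarith
qed simp

end

section \<open>Convergence in total variation\<close>

text \<open>
  The limit is the setwise limit. It is finitely additive, and continuous at the empty set because the
  convergence is uniform over all sets; hence it is a probability measure.
\<close>

lemma tv_Cauchy_imp_convergent:
  fixes N :: "nat \<Rightarrow> 'a::countable measure" and e :: "nat \<Rightarrow> real"
  assumes N: "\<And>n. prob_space (N n)" "\<And>n. sets (N n) = UNIV"
    and e: "e \<longlonglongrightarrow> 0"
    and Cauchy: "\<And>n m A. n \<le> m \<Longrightarrow> \<bar>measure (N m) A - measure (N n) A\<bar> \<le> e n"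
  obtains L :: "'a pmf" where "\<And>n A. \<bar>measure (N n) A - measure L A\<bar> \<le> e n"
proof -
  have fin: "finite_measure (N n)" for n
    using N(1) by (simp add: prob_space.finite_measure)
  define P where "P A = lim (\<lambda>n. measure (N n) A)" for A
  have "Cauchy (\<lambda>n. measure (N n) A)" for A
  proof (rule metric_CauchyI)
    fix r :: real assume "r > 0"
    then obtain k where k: "e k < r / 2"
      using order_tendstoD(2)[OF e, of "r / 2"] by (auto simp: eventually_sequentially)
    have "dist (measure (N m) A) (measure (N n) A) < r" if "m \<ge> k" "n \<ge> k" for m n
      using Cauchy[OF that(1), of A] Cauchy[OF that(2), of A] k by (auto simp: dist_real_def)
    then show "\<exists>k. \<forall>m\<ge>k. \<forall>n\<ge>k. dist (measure (N m) A) (measure (N n) A) < r" by blast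
  qed
  then have lim: "(\<lambda>n. measure (N n) A) \<longlonglongrightarrow> P A" for A
    unfolding P_def by (simp add: Cauchy_convergent_iff convergent_LIMSEQ_iff)
  have close: "\<bar>measure (N n) A - P A\<bar> \<le> e n" for n A
  proof (rule tendsto_upperbound)
    show "(\<lambda>m. \<bar>measure (N n) A - measure (N m) A\<bar>) \<longlonglongrightarrow> \<bar>measure (N n) A - P A\<bar>"
      by (intro tendsto_intros lim)
    show "\<forall>\<^sub>F m in sequentially. \<bar>measure (N n) A - measure (N m) A\<bar> \<le> e n"
      using eventually_ge_at_top[of n] by eventually_elim (simp add: Cauchy abs_minus_commute)
  qed simp
  have nonneg: "0 \<le> P A" for A
    by (rule LIMSEQ_le_const[OF lim]) simp
  have empty: "P {} = 0"
    using LIMSEQ_unique[OF lim[of "{}"]] by simp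
  have total: "P UNIV = 1"
  proof -
    have "measure (N n) UNIV = 1" for n
      using prob_space.prob_space[OF N(1), of n] sets_eq_imp_space_eq[of "N n" "count_space UNIV"] N(2)[of n] by simp
    then show ?thesis using LIMSEQ_unique[OF lim[of UNIV]] by simp
  qed
  have add: "P (A \<union> B) = P A + P B" if "A \<inter> B = {}" for A B
  proof (rule LIMSEQ_unique[OF lim])
    have "measure (N n) (A \<union> B) = measure (N n) A + measure (N n) B" for n
      using fin N(2) that by (intro finite_measure.finite_measure_Union) auto
    then show "(\<lambda>n. measure (N n) (A \<union> B)) \<longlonglongrightarrow> P A + P B"
      by (simp add: tendsto_add lim)
  qed
  define L where "L = measure_of UNIV UNIV (\<lambda>A. ennreal (P A))"
  have ca: "countably_additive UNIV (\<lambda>A. ennreal (P A))"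
  proof (rule ring_of_sets.empty_continuous_imp_countably_additive)
    show "ring_of_sets UNIV (UNIV :: 'a set set)"
      by (rule ring_of_setsI) auto
    show "positive UNIV (\<lambda>A. ennreal (P A))" by (simp add: positive_def empty)
    show "additive UNIV (\<lambda>A. ennreal (P A))"
      by (simp add: additive_def add nonneg)
    show "\<forall>A\<in>UNIV. ennreal (P A) \<noteq> \<infinity>" by simp
    fix A :: "nat \<Rightarrow> 'a set" assume A: "decseq A" "(\<Inter>i. A i) = {}"
    have "(\<lambda>i. P (A i)) \<longlonglongrightarrow> 0"
    proof (rule LIMSEQ_I)
      fix r :: real assume "r > 0"
      then obtain k where k: "e k < r / 2"
        using order_tendstoD(2)[OF e, of "r / 2"] by (auto simp: eventually_sequentially)
      have "(\<lambda>i. measure (N k) (A i)) \<longlonglongrightarrow> measure (N k) (\<Inter>i. A i)"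
        using A(1) N(2) by (intro finite_measure.finite_Lim_measure_decseq fin) auto
      then have "(\<lambda>i. measure (N k) (A i)) \<longlonglongrightarrow> 0" using A(2) by simp
      from LIMSEQ_D[OF this, of "r / 2"] \<open>r > 0\<close> obtain i0
        where i0: "\<And>i. i \<ge> i0 \<Longrightarrow> measure (N k) (A i) < r / 2" by auto
      have "norm (P (A i) - 0) < r" if "i \<ge> i0" for i
        using i0[OF that] close[of k "A i"] k nonneg[of "A i"] by auto
      then show "\<exists>no. \<forall>i\<ge>no. norm (P (A i) - 0) < r" by blast
    qed
    then show "(\<lambda>i. ennreal (P (A i))) \<longlonglongrightarrow> 0"
      using tendsto_ennrealI by fastforce
  qed
  have L_sets: "sets L = UNIV" and L_space: "space L = UNIV"
    unfolding L_def by (auto intro: sigma_sets.Basic)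
  have L_emeasure: "emeasure L A = ennreal (P A)" for A
    unfolding L_def
    by (rule emeasure_measure_of_sigma[OF _ _ ca])
       (auto simp: positive_def empty sigma_algebra_Pow[of UNIV, unfolded Pow_UNIV])
  have L_measure: "measure L A = P A" for A
    by (simp add: measure_def L_emeasure nonneg)
  have L_prob: "prob_space L"
    by (rule prob_spaceI) (simp add: L_space L_emeasure total)
  have "AE x in L. measure L {x} \<noteq> 0"
  proof -
    have "{x. measure L {x} = 0} \<in> null_sets L"
    proof -
      have "(\<Union>x\<in>{x. measure L {x} = 0}. {x}) \<in> null_sets L"
        by (intro null_sets_UN') (auto simp: null_sets_def L_sets L_emeasure L_measure)
      then show ?thesis by simp
    qed
    then show ?thesis by (rule AE_I') auto
  qed
  with L_prob L_sets have "measure_pmf (Abs_pmf L) = L"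
    by (intro Abs_pmf_inverse) auto
  with close L_measure that[of "Abs_pmf L"] show thesis by simp
qed

lemma tv_dist_nonneg_le:
  assumes "\<And>A. \<bar>measure M A - measure N A\<bar> \<le> e"
  shows "0 \<le> tv_dist M N" "tv_dist M N \<le> e"
proof -
  have "bdd_above ((\<lambda>A. \<bar>measure M A - measure N A\<bar>) ` sets M)"
    by (intro bdd_aboveI[of _ e]) (use assms in auto)
  moreover have "{} \<in> sets M" by simp
  ultimately show "0 \<le> tv_dist M N"
    unfolding tv_dist_def by (rule cSUP_upper2) simp
  show "tv_dist M N \<le> e"
    unfolding tv_dist_def using assms \<open>{} \<in> sets M\<close> by (intro cSUP_least) auto
qed

theorem lemma4:
  fixes q :: nat and t :: real
    and M :: "int \<Rightarrow> 'w measure" and Z :: "int \<Rightarrow> real \<Rightarrow> 'w \<Rightarrow> int"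
  assumes "primepow q"
    and "\<And>a. ctmc (M a) (Q_Z q) a (Z a)"
    and "t > 0"
  shows "\<exists>L :: (nat \<times> int) pmf.
    ((\<lambda>a. tv_dist
        (distr (M a) (count_space UNIV) (\<lambda>\<omega>. (down_jumps (\<lambda>s. Z a s \<omega>) t, Z a t \<omega>)))
        (measure_pmf L)) \<longlongrightarrow> 0) at_bot"
proof -
  have "q \<ge> 2" using primepow_gt_Suc_0[OF assms(1)] by simp
  then interpret q_chain q M Z by (rule q_chain.intro[OF _ assms(2)])
  define C where "C = 3 + 1 / t + 2 * real q"
  define e where "e n = C * (real n + 3) * (1 / 2) ^ n" for n
  define D where "D a = distr (M a) (count_space UNIV) (\<lambda>\<omega>. (down_jumps (\<lambda>s. Z a s \<omega>) t, Z a t \<omega>))" for a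
  have e_nonneg: "0 \<le> e n" for n
    using assms(3) by (simp add: e_def C_def)
  have D: "measure (D a) A = end_prob A a t" for a A
    unfolding D_def by (rule end_prob_eq) (use assms(3) in simp)
  have e: "e \<longlonglongrightarrow> 0"
  proof -
    have "(\<lambda>n. C * (real n * (1 / 2) ^ n) + 3 * C * (1 / 2) ^ n) \<longlonglongrightarrow> C * 0 + 3 * C * 0"
      by (intro tendsto_intros powser_times_n_limit_0 LIMSEQ_power_zero) auto
    then show ?thesis by (simp add: e_def[abs_def] algebra_simps)
  qed
  obtain L where L: "\<And>n A. \<bar>measure (D (- int n)) A - measure (measure_pmf L) A\<bar> \<le> e n"
  proof (rule tv_Cauchy_imp_convergent[OF _ _ e])
    fix n show "prob_space (D (- int n))"
      unfolding D_def using assms(3)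
      by (intro prob_space.prob_space_distr ctmc.axioms(1)[OF assms(2)] measurable_down_jumps_state) simp
    show "sets (D (- int n)) = UNIV" by (simp add: D_def)
    fix m A assume "n \<le> m"
    then show "\<bar>measure (D (- int m)) A - measure (D (- int n)) A\<bar> \<le> e n"
      using end_prob_Cauchy[OF assms(3), of n m A] e_nonneg[of m] unfolding D e_def C_def by linarith
  qed blast
  have "((\<lambda>a. tv_dist (D a) (measure_pmf L)) \<longlongrightarrow> 0) at_bot"
  proof (rule tendsto_sandwich[where f = "\<lambda>_. 0" and h = "\<lambda>a. e (nat (- a))"])
    have "filterlim (\<lambda>a. nat (- a)) sequentially at_bot"
      unfolding filterlim_at_top
    proof
      fix n show "\<forall>\<^sub>F a in at_bot. n \<le> nat (- a)"
        using eventually_le_at_bot[of "- int n"] by eventually_elim simp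
    qed
    then show "((\<lambda>a. e (nat (- a))) \<longlongrightarrow> 0) at_bot"
      by (rule filterlim_compose[OF e])
    show "\<forall>\<^sub>F a in at_bot. tv_dist (D a) (measure_pmf L) \<le> e (nat (- a))"
      using eventually_le_at_bot[of 0]
    proof eventually_elim
      case (elim a)
      then show ?case using tv_dist_nonneg_le(2)[OF L, of "nat (- a)"] by simp
    qed
    show "\<forall>\<^sub>F a in at_bot. 0 \<le> tv_dist (D a) (measure_pmf L)"
      using eventually_le_at_bot[of 0]
    proof eventually_elim
      case (elim a)
      then show ?case using tv_dist_nonneg_le(1)[OF L, of "nat (- a)"] by simp
    qed
  qed simp
  then show ?thesis unfolding D_def by blast
qed

end
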